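(* Let $\gamma\in(0,\infty)$, $\mathbf U(x_1,x_2)=(2-\sin(2\pi x_1)-\sin(2\pi x_2))^\gamma$ on $\mathbb T^2$, and let $\xi\in\mathbb R^2$ have Diophantine index $\sigma_\xi=1$. Then there is a constant $C>0$ (independent of $T$) such that for all sufficiently large $T$: $$\frac1T\int_0^T\frac{dx}{\mathbf U(\xi x)^{1/2}}\ \ge\ \begin{cases}C\,T^{\tau},\quad \tau=\frac{(\gamma-2)(3\gamma-2)}{(\gamma-2)(3\gamma-2)+4\gamma^2},&\gamma\in(2,\infty),\\[2pt] C|\log(T)|,&\gamma=2,\end{cases}$$ and $$\left|\frac1T\int_0^T\frac{dx}{\mathbf U(\xi x)^{1/2}}-\int_{\mathbb T^2}\frac{d\mathbf x}{\mathbf U(\mathbf x)^{1/2}}\right|\ \le\ \begin{cases}C\,T^{-\tau},\quad \tau=\frac12\,\frac{2-\gamma}{2+\gamma},&\gamma\in[1,2),\\[2pt] C\,T^{-\tau},\quad \tau=\frac{\gamma}{1+\gamma}\,\frac{2-\gamma}{2+\gamma},&\gamma\in(\frac23,1),\\[2pt] C\,T^{-1/5}|\log(T)|,&\gamma=\frac23,\\[2pt] C\,T^{-\tau},\quad \tau=\frac12\,\frac{\gamma}{1+\gamma},&\gamma\in(0,\frac23).\end{cases}$$ Furthermore, the result for $\gamma>2$ holds for all non-resonant $\xi\in\mathbb R^2$ with $\sigma_\xi<2$.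
   Context: $\mathbb T^2=\mathbb R^2/\mathbb Z^2$; functions on $\mathbb T^2$ are identified with $\mathbb Z^2$-periodic functions, and $\xi x=(\xi_1x,\xi_2x)$ for $x\in\mathbb R$. $\xi\in\mathbb R^2$ is non-resonant if $\kappa\cdot\xi\neq0$ for all $\kappa\in\mathbb Z^2\setminus\{0\}$, and has Diophantine index $\sigma=\sigma_\xi>0$ if there is $C_\xi>0$ with $|\xi\cdot\kappa|\ge C_\xi|\kappa|^{-\sigma}$ for all $\kappa\in\mathbb Z^2\setminus\{0\}$. *)

theory Defs
  imports "HOL-Analysis.Analysis"
begin

definition int_lattice :: "(real^2) set" where
  "int_lattice = {\<kappa>. \<forall>i. \<kappa> $ i \<in> \<int>}"

definition non_resonant :: "real^2 \<Rightarrow> bool" where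
  "non_resonant \<xi> \<longleftrightarrow> (\<forall>\<kappa>\<in>int_lattice - {0}. \<kappa> \<bullet> \<xi> \<noteq> 0)"

text \<open>The index is an admissible exponent, not the optimal one:
  if \<open>\<sigma>\<close> is an index of \<open>\<xi>\<close>, then so is every larger exponent.\<close>

definition diophantine_index :: "real^2 \<Rightarrow> real \<Rightarrow> bool" where
  "diophantine_index \<xi> \<sigma> \<longleftrightarrow>
     \<sigma> > 0 \<and> (\<exists>C>0. \<forall>\<kappa>\<in>int_lattice - {0}. \<bar>\<xi> \<bullet> \<kappa>\<bar> \<ge> C * norm \<kappa> powr (- \<sigma>))"

text \<open>Functions on the torus are \<open>\<int>\<^sup>2\<close>-periodic functions on the plane, and the integral
  over the torus is the Lebesgue integral over the fundamental cell \<open>[0,1]\<^sup>2\<close>.\<close>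

definition torus_cell :: "(real^2) set" where
  "torus_cell = {x. \<forall>i. 0 \<le> x $ i \<and> x $ i \<le> 1}"

definition torus_integrable :: "(real^2 \<Rightarrow> real) \<Rightarrow> bool" where
  "torus_integrable f \<longleftrightarrow> set_integrable lborel torus_cell f"

definition torus_integral :: "(real^2 \<Rightarrow> real) \<Rightarrow> real" where
  "torus_integral f = (LBINT x:torus_cell. f x)"

definition line_integrable :: "(real^2 \<Rightarrow> real) \<Rightarrow> real^2 \<Rightarrow> real \<Rightarrow> bool" where
  "line_integrable f \<xi> T \<longleftrightarrow> set_integrable lborel {0..T} (\<lambda>x. f (x *\<^sub>R \<xi>))"

definition line_average :: "(real^2 \<Rightarrow> real) \<Rightarrow> real^2 \<Rightarrow> real \<Rightarrow> real" where
  "line_average f \<xi> T = (1 / T) * (LBINT x:{0..T}. f (x *\<^sub>R \<xi>))"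

definition U :: "real \<Rightarrow> real^2 \<Rightarrow> real" where
  "U \<gamma> x = (2 - sin (2 * pi * x $ 1) - sin (2 * pi * x $ 2)) powr \<gamma>"

text \<open>\<open>U \<gamma>\<close> vanishes exactly on \<open>(1/4, 1/4) + \<int>\<^sup>2\<close>, where division by zero gives the value 0
  instead of infinity. This null set does not affect the integral over the torus, and a line
  through the origin with non-resonant direction does not meet it.\<close>

definition inv_sqrt_U :: "real \<Rightarrow> real^2 \<Rightarrow> real" where
  "inv_sqrt_U \<gamma> x = 1 / (U \<gamma> x) powr (1/2)"

end

theory Submission imports Defs begin

text \<open>
  Put \<open>\<rho>\<^sup>2 = 2 - sin (2\<pi>x\<^sub>1) - sin (2\<pi>x\<^sub>2)\<close>, so that the integrand is \<open>\<rho>\<close> to the power \<open>-\<gamma>\<close>. Since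
  \<open>1 - sin (2\<pi>t) = 2 sin\<^sup>2 (\<pi>(t - 1/4))\<close>, the function \<open>\<rho>\<close> is Lipschitz and comparable to the distance
  to \<open>(1/4, 1/4) + \<int>\<^sup>2\<close>.

  Dirichlet's theorem gives coprime \<open>p, q\<close> such that the flow at time \<open>q / |\<xi>\<^sub>1|\<close> nearly returns, and the
  Diophantine condition bounds \<open>q\<close> from below. Along the closed line of direction \<open>(q, p)\<close> the average
  of an \<open>L\<close>-Lipschitz function is within \<open>L / q\<close> of its mean, because its vertical translates by
  \<open>1/q\<close> are the same line. For index 1 and \<open>q \<approx> T\<^bsup>1/2\<^esup>\<close> the flow thus averages Lipschitz functions up
  to \<open>O((L + sup) T\<^bsup>-1/2\<^esup>)\<close>.

  For \<open>\<gamma> < 2\<close> truncate \<open>\<rho>\<close> from below at \<open>r = T\<^bsup>-1/6\<^esup>\<close>. Two visits of the line to a \<open>d\<close>-neighbourhood of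
  the singularity are at distance at least \<open>c/d\<close>, and there is none before time \<open>c/d\<close>; hence it spends
  at most the proportion \<open>O(d\<^sup>2)\<close> of its time there, and the truncation costs \<open>O(r\<^bsup>2-\<gamma>\<^esup>)\<close>. All errors
  are \<open>O(T\<^bsup>-(2-\<gamma>)/6\<^esup>)\<close>, which is at least as good as each of the claimed rates. For \<open>\<gamma> = 2\<close> the mean of
  the truncated function grows like \<open>log (1/r)\<close>. For \<open>\<gamma> > 2\<close> each near-period of length about \<open>q\<close>
  contains a visit at distance \<open>O(1/q)\<close> lasting for a time of order \<open>1/q\<close>, which yields the growth
  \<open>T\<^bsup>(\<gamma>-2)/\<sigma>\<^esup>\<close>.
\<close>

subsection \<open>The distance to the singularity\<close>

definition rho :: "real \<Rightarrow> real \<Rightarrow> real" where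
  "rho a b = sqrt (2 - sin (2 * pi * a) - sin (2 * pi * b))"

lemma rho_nonneg [simp]: "0 \<le> rho a b"
proof -
  have "0 \<le> 2 - sin (2 * pi * a) - sin (2 * pi * b)"
    using sin_le_one[of "2 * pi * a"] sin_le_one[of "2 * pi * b"] by linarith
  then show ?thesis by (simp add: rho_def)
qed

lemma rho_periodic: "rho (a + of_int m) (b + of_int n) = rho a b"
proof -
  have *: "sin (2 * pi * (x + of_int k)) = sin (2 * pi * x)" for x :: real and k :: int
    using sin.plus_of_int[of "2 * pi * x" k] by (simp add: algebra_simps)
  show ?thesis unfolding rho_def by (simp add: *)
qed

lemma one_minus_sin: "1 - sin (2 * pi * a) = 2 * (sin (pi * (a - 1/4)))\<^sup>2"
proof -
  have "cos (2 * (pi * (a - 1/4))) = sin (2 * pi * a)"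
    using cos_sin_eq[of "2 * (pi * (a - 1/4))"] 
    by (simp add: algebra_simps cos_diff)
  then show ?thesis by (simp add: cos_double_sin)
qed

text \<open>The definition takes the root of a function that vanishes at the singularity, which
  hides the Lipschitz property; as a norm, \<open>rho\<close> obeys the reverse triangle inequality
  there too.\<close>

lemma rho_eq_norm: "rho a b = sqrt 2 * norm (sin (pi * (a - 1/4)), sin (pi * (b - 1/4)))"
proof -
  have "2 - sin (2 * pi * a) - sin (2 * pi * b) = 
      2 * ((sin (pi * (a - 1/4)))\<^sup>2 + (sin (pi * (b - 1/4)))\<^sup>2)"
    using one_minus_sin[of a] one_minus_sin[of b] by (simp add: algebra_simps)
  then show ?thesis unfolding rho_def norm_prod_def by (simp only: real_sqrt_mult fst_conv snd_conv real_norm_def power2_abs)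
qed

lemma sin_lipschitz: "\<bar>sin x - sin y\<bar> \<le> \<bar>x - y\<bar>" for x y :: real
proof -
  have "sin x - sin y = 2 * sin ((x - y) / 2) * cos ((x + y) / 2)"
    by (rule sin_diff_sin)
  then have "\<bar>sin x - sin y\<bar> = 2 * (\<bar>sin ((x - y) / 2)\<bar> * \<bar>cos ((x + y) / 2)\<bar>)"
    by (simp add: abs_mult)
  also have "\<dots> \<le> 2 * (\<bar>(x - y) / 2\<bar> * 1)"
    by (intro mult_left_mono mult_mono abs_sin_x_le_abs_x) auto
  finally show ?thesis by simp
qed

lemma rho_lipschitz: "\<bar>rho a b - rho a' b'\<bar> \<le> 6 * (\<bar>a - a'\<bar> + \<bar>b - b'\<bar>)"
proof -
  let ?v = "\<lambda>a b. (sin (pi * (a - 1/4)), sin (pi * (b - 1/4))) :: real \<times> real"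
  \<comment> \<open>The constant 6 is \<open>3/2 * 4\<close>, a crude bound for the factor
    \<open>sqrt 2\<close> of the norm form times the Lipschitz constant of
    \<open>sin (pi * t)\<close>.\<close>
  have s: "sqrt 2 * pi \<le> 6"
  proof -
    have "sqrt 2 \<le> (3/2 :: real)" by (rule real_le_lsqrt) (auto simp: power2_eq_square)
    moreover have "pi \<le> 4" using pi_less_4 by simp
    ultimately have "sqrt 2 * pi \<le> 3/2 * 4" by (intro mult_mono) auto
    then show ?thesis by simp
  qed
  have "\<bar>rho a b - rho a' b'\<bar> = sqrt 2 * \<bar>norm (?v a b) - norm (?v a' b')\<bar>"
    unfolding rho_eq_norm by (simp add: abs_mult right_diff_distrib[symmetric])
  also have "\<dots> \<le> sqrt 2 * norm (?v a b - ?v a' b')"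
    by (intro mult_left_mono norm_triangle_ineq3) auto
  also have "norm (?v a b - ?v a' b') \<le> pi * \<bar>a - a'\<bar> + pi * \<bar>b - b'\<bar>"
  proof -
    have "norm (?v a b - ?v a' b') \<le> norm (fst (?v a b - ?v a' b')) + norm (snd (?v a b - ?v a' b'))"
      by (metis norm_Pair_le prod.collapse)
    also have "\<dots> \<le> \<bar>pi * (a - 1/4) - pi * (a' - 1/4)\<bar> + \<bar>pi * (b - 1/4) - pi * (b' - 1/4)\<bar>"
      by (simp only: fst_diff snd_diff fst_conv snd_conv real_norm_def) (intro add_mono sin_lipschitz)
    also have "\<dots> = pi * \<bar>a - a'\<bar> + pi * \<bar>b - b'\<bar>"
      by (simp add: right_diff_distrib[symmetric] abs_mult)
    finally show ?thesis .
  qed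
  finally have "\<bar>rho a b - rho a' b'\<bar> \<le> (sqrt 2 * pi) * (\<bar>a - a'\<bar> + \<bar>b - b'\<bar>)"
    by (simp add: algebra_simps)
  also have "\<dots> \<le> 6 * (\<bar>a - a'\<bar> + \<bar>b - b'\<bar>)"
    by (intro mult_right_mono s) auto
  finally show ?thesis .
qed

text \<open>Sine is concave on \<open>{0..pi}\<close>, so on \<open>{0..pi/2}\<close> it lies above
  its chord. This gives \<open>2 * t\<close> for nonnegative \<open>t\<close>, of which only
  \<open>t\<close> is kept; oddness covers negative \<open>t\<close>.\<close>

lemma abs_sin_ge: "\<bar>t\<bar> \<le> 1/2 \<Longrightarrow> \<bar>t\<bar> \<le> \<bar>sin (pi * t)\<bar>"
proof -
  have pos: "t \<le> sin (pi * t)" if t: "0 \<le> t" "t \<le> 1/2" for t :: real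
  proof -
    have "convex_on {0..pi} (\<lambda>x. - sin x)"
      by (rule f''_ge0_imp_convex[where f' = "\<lambda>x. - cos x" and f'' = "\<lambda>x. sin x"])
        (auto intro!: derivative_eq_intros sin_ge_zero)
    from convex_onD[OF this, of "2 * t" 0 "pi/2"] t
    have "- sin (pi * t) \<le> - (2 * t)" by (simp add: mult.commute)
    then show ?thesis using t by linarith
  qed
  assume t: "\<bar>t\<bar> \<le> 1/2"
  show ?thesis
  proof (cases "0 \<le> t")
    case True then show ?thesis using pos[of t] t by simp
  next
    case False then show ?thesis using pos[of "-t"] t by simp
  qed
qed

text \<open>The integers nearest to \<open>a - 1/4\<close> and \<open>b - 1/4\<close> serve: after
  subtracting them the sine bounds its argument from above, and each sine is at most the
  norm.\<close>

lemma rho_less_near: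
  assumes "rho a b < d"
  obtains m n :: int where "\<bar>a - 1/4 - of_int m\<bar> < d" "\<bar>b - 1/4 - of_int n\<bar> < d"
proof -
  have near: "\<bar>x - of_int (round x)\<bar> \<le> \<bar>sin (pi * x)\<bar>" for x :: real
  proof -
    \<comment> \<open>An odd shift flips the sign of the sine, so only its square has period 1 in
      \<open>x\<close>.\<close>
    have *: "sin (pi * (x - of_int k)) ^ 2 = sin (pi * x) ^ 2" for k :: int
      by (simp add: algebra_simps sin_diff power_mult_distrib sin_squared_eq)
    have "\<bar>x - of_int (round x)\<bar> \<le> 1/2"
      using of_int_round_abs_le[of x] by (simp add: abs_minus_commute)
    then have "\<bar>x - of_int (round x)\<bar> \<le> \<bar>sin (pi * (x - of_int (round x)))\<bar>" by (rule abs_sin_ge)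
    also have "\<dots> = \<bar>sin (pi * x)\<bar>" by (metis * power2_abs power2_eq_iff_nonneg abs_ge_zero)
    finally show ?thesis .
  qed
  let ?v = "(sin (pi * (a - 1/4)), sin (pi * (b - 1/4)))"
  have "norm ?v \<le> sqrt 2 * norm ?v" by (simp add: mult_le_cancel_right1)
  then have v: "norm ?v < d" using assms unfolding rho_eq_norm by linarith
  have "\<bar>sin (pi * (a - 1/4))\<bar> < d" "\<bar>sin (pi * (b - 1/4))\<bar> < d"
    using v norm_fst_le[of "sin (pi * (a - 1/4))" "sin (pi * (b - 1/4))"]
      norm_snd_le[of "sin (pi * (b - 1/4))" "sin (pi * (a - 1/4))"] by auto
  then show ?thesis
    using near[of "a - 1/4"] near[of "b - 1/4"]
    by (intro that[of "round (a - 1/4)" "round (b - 1/4)"]) linarith+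
qed

lemma rho_zeroE:
  assumes "rho a b = 0"
  obtains m n :: int where "a = 1/4 + of_int m" "b = 1/4 + of_int n"
proof -
  have "sin (pi * (a - 1/4)) = 0" "sin (pi * (b - 1/4)) = 0"
    using assms unfolding rho_eq_norm by (auto simp: norm_eq_zero zero_prod_def)
  then obtain m n :: int where "pi * (a - 1/4) = of_int m * pi" "pi * (b - 1/4) = of_int n * pi"
    unfolding sin_zero_iff_int2 by blast
  then have "a = 1/4 + of_int m" "b = 1/4 + of_int n" by (auto simp: mult.commute)
  then show ?thesis by (rule that)
qed

text \<open>The Lipschitz bound is applied between the given point and the singular point, where
  \<open>rho\<close> is 0.\<close>

lemma rho_upper: "rho (1/4 + of_int m + a) (1/4 + of_int n + b) \<le> 6 * (\<bar>a\<bar> + \<bar>b\<bar>)"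
proof -
  have "rho (1/4) (1/4) = 0" by (simp add: rho_eq_norm)
  then have "rho (1/4 + of_int m) (1/4 + of_int n) = 0"
    using rho_periodic[of "1/4" m "1/4" n] by simp
  then show ?thesis
    using rho_lipschitz[of "1/4 + of_int m + a" "1/4 + of_int n + b" "1/4 + of_int m" "1/4 + of_int n"]
    by simp
qed

lemma continuous_on_rho [continuous_intros]:
  fixes f g :: "'a::t2_space \<Rightarrow> real"
  shows "continuous_on S f \<Longrightarrow> continuous_on S g \<Longrightarrow> continuous_on S (\<lambda>x. rho (f x) (g x))"
  unfolding rho_def by (intro continuous_intros)

text \<open>Valid at the singularity as well: there both sides are 0, by division by zero on the
  left and by \<open>0 powr _ = 0\<close> on the right.\<close>

lemma inv_sqrt_U_eq: "inv_sqrt_U \<gamma> x = rho (x $ 1) (x $ 2) powr (- \<gamma>)"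
proof -
  have "rho (x $ 1) (x $ 2) ^ 2 = 2 - sin (2 * pi * x $ 1) - sin (2 * pi * x $ 2)"
    using sin_le_one[of "2 * pi * x $ 1"] sin_le_one[of "2 * pi * x $ 2"]
    unfolding rho_def by (intro real_sqrt_pow2) linarith
  moreover have "((r ^ 2) powr \<gamma>) powr (1/2) = r powr \<gamma>" if "0 \<le> r" for r :: real
  proof (cases "r = 0")
    case False
    then have "r ^ 2 = r powr 2" using that by simp
    then show ?thesis by (simp only: powr_powr) simp
  qed simp
  ultimately show ?thesis
    unfolding inv_sqrt_U_def U_def by (metis powr_minus_divide rho_nonneg)
qed

text \<open>Truncation by \<open>max\<close>, unlike multiplication by an indicator, keeps the
  function Lipschitz for positive \<open>r\<close>.\<close>

definition rho_cut :: "real \<Rightarrow> real \<Rightarrow> real \<Rightarrow> real \<Rightarrow> real" where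
  "rho_cut \<gamma> r a b = max (rho a b) r powr (- \<gamma>)"

text \<open>On \<open>{r..}\<close> the derivative of \<open>x powr (- \<gamma>)\<close> is at most
  \<open>\<gamma> * r powr (- \<gamma> - 1)\<close> in absolute value; the mean value bound is
  combined with the Lipschitz constant 6 of \<open>rho\<close>.\<close>

lemma rho_cut_lipschitz:
  assumes "0 < r" "0 < \<gamma>"
  shows "\<bar>rho_cut \<gamma> r a b - rho_cut \<gamma> r a' b'\<bar> \<le> 6 * \<gamma> * r powr (- \<gamma> - 1) * (\<bar>a - a'\<bar> + \<bar>b - b'\<bar>)"
proof -
  have *: "\<bar>u powr (- \<gamma>) - v powr (- \<gamma>)\<bar> \<le> \<gamma> * r powr (- \<gamma> - 1) * \<bar>u - v\<bar>"
    if "r \<le> u" "r \<le> v" for u v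
  proof -
    have "norm (u powr (- \<gamma>) - v powr (- \<gamma>)) \<le> \<gamma> * r powr (- \<gamma> - 1) * norm (u - v)"
    proof (rule field_differentiable_bound[where S = "{r..}" and f' = "\<lambda>x. - \<gamma> * x powr (- \<gamma> - 1)"])
      fix z assume z: "z \<in> {r..}"
      show "((\<lambda>x. x powr (- \<gamma>)) has_field_derivative - \<gamma> * z powr (- \<gamma> - 1)) (at z within {r..})"
        using z assms by (auto intro!: derivative_eq_intros simp: powr_diff field_simps)
      have "z powr (- \<gamma> - 1) \<le> r powr (- \<gamma> - 1)"
        using z assms by (intro powr_mono2') auto
      then show "norm (- \<gamma> * z powr (- \<gamma> - 1)) \<le> \<gamma> * r powr (- \<gamma> - 1)"
        using assms by (simp add: abs_mult)
    qed (use that in auto)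
    then show ?thesis by simp
  qed
  have "\<bar>rho_cut \<gamma> r a b - rho_cut \<gamma> r a' b'\<bar> \<le> \<gamma> * r powr (- \<gamma> - 1) * \<bar>max (rho a b) r - max (rho a' b') r\<bar>"
    unfolding rho_cut_def by (rule *) auto
  also have "\<dots> \<le> \<gamma> * r powr (- \<gamma> - 1) * \<bar>rho a b - rho a' b'\<bar>"
    using assms by (intro mult_left_mono) auto
  also have "\<dots> \<le> \<gamma> * r powr (- \<gamma> - 1) * (6 * (\<bar>a - a'\<bar> + \<bar>b - b'\<bar>))"
    using assms by (intro mult_left_mono rho_lipschitz) auto
  finally show ?thesis by (simp only: mult_ac)
qed

lemma rho_cut_periodic: "rho_cut \<gamma> r (a + of_int m) (b + of_int n) = rho_cut \<gamma> r a b"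
  by (simp add: rho_cut_def rho_periodic)

lemma rho_cut_nonneg: "0 \<le> rho_cut \<gamma> r a b"
  by (simp add: rho_cut_def)

lemma rho_cut_le: "0 < r \<Longrightarrow> 0 < \<gamma> \<Longrightarrow> rho_cut \<gamma> r a b \<le> r powr (- \<gamma>)"
  unfolding rho_cut_def by (rule powr_mono2') auto

subsection \<open>Averages over closed lines\<close>

text \<open>Only the fractional part \<open>e\<close> of \<open>c\<close> matters. The part of the
  window \<open>{e..1 + e}\<close> beyond 1 is moved back by one period onto
  \<open>{0..e}\<close>.\<close>

lemma integral_unit_shift:
  fixes h :: "real \<Rightarrow> real"
  assumes cont: "continuous_on UNIV h" and per: "\<And>x. h (x + 1) = h x"
  shows "integral {0..1} (\<lambda>x. h (x + c)) = integral {0..1} h"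
proof -
  have int: "h integrable_on {a..b}" for a b
    by (rule integrable_continuous_real) (rule continuous_on_subset[OF cont], simp)
  have shift: "integral {a..b} (\<lambda>x. h (x + d)) = integral {a + d..b + d} h" for a b d
    using integral_shift_Icc_real[of a b h d] by (simp add: comp_def add.commute)
  have per_nat: "h (x + of_int k) = h x" for x and k :: int
  proof (induction k rule: int_induct[where k = 0])
    case (step1 i) then show ?case using per[of "x + of_int i"] by (simp add: add.assoc)
  next
    case (step2 i) then show ?case using per[of "x + of_int (i - 1)"] by (simp add: add.assoc)
  qed simp
  define e where "e = frac c"
  have e: "0 \<le> e" "e < 1" by (auto simp: e_def frac_lt_1)
  have "integral {0..1} (\<lambda>x. h (x + c)) = integral {0..1} (\<lambda>x. h (x + e))"
  proof (rule arg_cong[where f = "integral {0..1}"], rule ext)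
    fix x show "h (x + c) = h (x + e)"
      using per_nat[of "x + e" "\<lfloor>c\<rfloor>"] by (simp add: e_def frac_def)
  qed
  also have "\<dots> = integral {e..1 + e} h" using shift[of 0 1 e] by simp
  also have "\<dots> = integral {e..1} h + integral {1..1 + e} h"
    by (rule Henstock_Kurzweil_Integration.integral_combine[symmetric]) (use e int in auto)
  also have "integral {1..1 + e} h = integral {0..e} h"
    using shift[of 0 e 1] per by (simp add: add.commute)
  also have "integral {e..1} h + integral {0..e} h = integral {0..1} h"
    using Henstock_Kurzweil_Integration.integral_combine[of 0 e 1 h] e int by simp
  finally show ?thesis .
qed

text \<open>For positive \<open>q\<close> stretching turns the integral into one over
  \<open>q\<close> full periods, divided by \<open>q\<close>. Negative \<open>q\<close> is reduced
  to this by reflecting \<open>s\<close> and shifting it by 1.\<close>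

lemma integral_unit_scale:
  fixes h :: "real \<Rightarrow> real" and q :: int
  assumes cont: "continuous_on UNIV h" and per: "\<And>x. h (x + 1) = h x" and "q \<noteq> 0"
  shows "integral {0..1} (\<lambda>s. h (c + of_int q * s)) = integral {0..1} h"
proof -
  have int: "(\<lambda>x. h (c + x)) integrable_on {a..b}" for a b c
    by (rule integrable_continuous_real)
      (rule continuous_on_compose2[OF cont], auto intro!: continuous_intros)
  have pos: "integral {0..1} (\<lambda>s. h (c + real n * s)) = integral {0..1} h" if n: "0 < n" for n c
  proof -
    have sum: "integral {0..real k} (\<lambda>x. h (c + x)) = real k * integral {0..1} h" for k
    proof (induction k)
      case (Suc k)
      have "integral {0..real (Suc k)} (\<lambda>x. h (c + x)) =
          integral {0..real k} (\<lambda>x. h (c + x)) + integral {real k..real (Suc k)} (\<lambda>x. h (c + x))"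
        by (intro Henstock_Kurzweil_Integration.integral_combine[symmetric] int) auto
      also have "integral {real k..real (Suc k)} (\<lambda>x. h (c + x)) =
          integral {0..1} (\<lambda>x. h (x + (c + real k)))"
        using integral_shift_Icc_real[of 0 1 "\<lambda>x. h (c + x)" "real k"]
        by (simp add: comp_def add_ac)
      also have "\<dots> = integral {0..1} h" by (rule integral_unit_shift[OF cont per])
      finally show ?case using Suc by (simp add: algebra_simps)
    qed simp
    have "((\<lambda>x. h (c + x)) has_integral real n * integral {0..1} h) {0..real n}"
      using int[of c 0 "real n"] sum[of n] by (simp add: has_integral_iff)
    from has_integral_stretch_real[OF this, of "real n"] n
    have "((\<lambda>s. h (c + real n * s)) has_integral integral {0..1} h) ((\<lambda>x. x / real n) ` {0..real n})"
      by simp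
    also have "(\<lambda>x. x / real n) ` {0..real n} = {0..1}"
      using n by (simp add: image_divide_atLeastAtMost)
    finally show ?thesis by (rule integral_unique)
  qed
  show ?thesis
  proof (cases "0 < q")
    case True
    then show ?thesis using pos[of "nat q" c] by simp
  next
    case False
    have "integral {0..1} (\<lambda>s. h (c + of_int q * s)) = 
        integral {-1..0} (\<lambda>s. h (c + of_int q * (- s)))"
      using Henstock_Kurzweil_Integration.integral_reflect_real[of 1 0 "\<lambda>s. h (c + of_int q * s)"] by simp
    also have "\<dots> = integral {0..1} (\<lambda>s. h (c + of_int q + of_int (- q) * s))"
      using integral_shift_Icc_real[of "-1" 0 "\<lambda>s. h (c + of_int q + of_int (- q) * s)" 1]
      by (simp add: comp_def algebra_simps)
    also have "\<dots> = integral {0..1} h"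
      using pos[of "nat (- q)" "c + of_int q"] False \<open>q \<noteq> 0\<close> by simp
    finally show ?thesis .
  qed
qed

lemma abs_integral_le:
  fixes F :: "real \<Rightarrow> real"
  assumes "a \<le> b" "continuous_on {a..b} F" "\<And>x. \<lbrakk>a \<le> x; x \<le> b\<rbrakk> \<Longrightarrow> \<bar>F x\<bar> \<le> B"
  shows "\<bar>integral {a..b} F\<bar> \<le> B * (b - a)"
  using integral_bound[of a b F B] assms by auto

text \<open>Averaging is proved for this class because the truncated integrands belong to it with a
  constant that depends on the truncation level, and that level varies with
  \<open>T\<close>.\<close>

locale lipschitz_torus =
  fixes g :: "real \<Rightarrow> real \<Rightarrow> real" and L :: real
  assumes periodic: "\<And>a b (m::int) (n::int). g (a + of_int m) (b + of_int n) = g a b"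
    and lipschitz: "\<And>a b a' b'. \<bar>g a b - g a' b'\<bar> \<le> L * (\<bar>a - a'\<bar> + \<bar>b - b'\<bar>)"
begin

text \<open>The iterated form suits the exchange of integrals along closed lines;
  \<open>torus_integral_eq_mean\<close> identifies it with the Lebesgue integral over the
  cell.\<close>

definition mean :: real where
  "mean = integral {0..1} (\<lambda>a. integral {0..1} (g a))"

lemma L_nonneg: "0 \<le> L"
  using lipschitz[of 0 0 1 0] by simp

lemma continuous_on_g [continuous_intros]:
  fixes f h :: "'a::topological_space \<Rightarrow> real"
  assumes "continuous_on S f" "continuous_on S h"
  shows "continuous_on S (\<lambda>x. g (f x) (h x))"
proof -
  have "(2 * L)-lipschitz_on UNIV (\<lambda>x. g (fst x) (snd x))"
  proof (rule lipschitz_onI)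
    fix x y :: "real \<times> real"
    have "dist (g (fst x) (snd x)) (g (fst y) (snd y)) \<le> L * (dist (fst x) (fst y) + dist (snd x) (snd y))"
      using lipschitz by (simp add: dist_real_def)
    also have "\<dots> \<le> L * (dist x y + dist x y)"
      by (intro mult_left_mono add_mono dist_fst_le dist_snd_le L_nonneg)
    finally show "dist (g (fst x) (snd x)) (g (fst y) (snd y)) \<le> 2 * L * dist x y" by simp
  qed (use L_nonneg in simp)
  then have "continuous_on UNIV (\<lambda>x. g (fst x) (snd x))" by (rule lipschitz_on_continuous_on)
  from continuous_on_compose2[OF this, of S "\<lambda>x. (f x, h x)"] assms
  show ?thesis by (simp add: continuous_on_Pair)
qed

text \<open>The integral \<open>H y\<close> over the translated line is \<open>1/q\<close>-periodic in \<open>y\<close>, since the translation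
  by \<open>1/q\<close> amounts to a shift of the parameter, and its mean over \<open>y\<close> is the mean of \<open>g\<close>.\<close>

lemma closed_line:
  fixes p q :: int
  assumes "q \<noteq> 0" "coprime p q"
  shows "\<bar>integral {0..1} (\<lambda>s. g (z1 + of_int q * s) (z2 + of_int p * s)) - mean\<bar> \<le> L / \<bar>of_int q\<bar>"
proof -
  define H where "H y = integral {0..1} (\<lambda>s. g (z1 + of_int q * s) (z2 + of_int p * s + y))" for y
  have int: "(\<lambda>s. g (z1 + of_int q * s) (z2 + of_int p * s + y)) integrable_on {0..1}" for y
    by (intro integrable_continuous_real continuous_intros)
  have H_lip: "\<bar>H y - H y'\<bar> \<le> L * \<bar>y - y'\<bar>" for y y'
  proof -
    have "H y - H y' = integral {0..1}
      (\<lambda>s. g (z1 + of_int q * s) (z2 + of_int p * s + y) - g (z1 + of_int q * s) (z2 + of_int p * s + y'))"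
      unfolding H_def by (intro integral_diff[symmetric] int)
    also have "\<bar>\<dots>\<bar> \<le> L * \<bar>y - y'\<bar> * (1 - 0)"
    proof (intro abs_integral_le continuous_intros)
      fix s
      show "\<bar>g (z1 + of_int q * s) (z2 + of_int p * s + y) - g (z1 + of_int q * s) (z2 + of_int p * s + y')\<bar>
          \<le> L * \<bar>y - y'\<bar>"
        using lipschitz[of "z1 + of_int q * s" "z2 + of_int p * s + y" "z1 + of_int q * s" "z2 + of_int p * s + y'"]
        by simp
    qed auto
    finally show ?thesis by simp
  qed
  \<comment> \<open>Bezout coefficients give the parameter shift: moving \<open>s\<close> by
    \<open>k * u / q\<close> changes the first coordinate by the integer \<open>k * u\<close> and
    the second by \<open>k / q\<close> up to an integer.\<close>
  obtain u v where uv: "u * p + v * q = 1"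
    using bezout_int[of p q] assms by auto
  have H_per: "H (y + of_int k / of_int q) = H y" for y and k :: int
  proof -
    let ?K = "\<lambda>s. g (z1 + of_int q * s) (z2 + of_int p * s + y)"
    have shift: "?K (s + of_int (k * u) / of_int q) =
        g (z1 + of_int q * s) (z2 + of_int p * s + (y + of_int k / of_int q))" for s
    proof -
      have "of_int u * of_int p + of_int v * of_int q = (1::real)"
        using uv by (metis of_int_1 of_int_add of_int_mult)
      then have "of_int p * (of_int (k * u) / of_int q) = (of_int k * (1 - of_int v * of_int q) / of_int q :: real)"
        by (simp add: algebra_simps) (simp add: algebra_simps flip: distrib_left)
      also have "\<dots> = of_int k / of_int q + of_int (- k * v)"
        using assms by (simp add: field_simps)
      finally have "z2 + of_int p * (s + of_int (k * u) / of_int q) + y =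
          (z2 + of_int p * s + (y + of_int k / of_int q)) + of_int (- k * v)"
        by (simp add: algebra_simps)
      moreover have "z1 + of_int q * (s + of_int (k * u) / of_int q) = (z1 + of_int q * s) + of_int (k * u)"
        using assms by (simp add: field_simps)
      ultimately show ?thesis by (simp only: periodic)
    qed
    have "integral {0..1} (\<lambda>s. ?K (s + of_int (k * u) / of_int q)) = integral {0..1} ?K"
    proof (rule integral_unit_shift)
      show "?K (s + 1) = ?K s" for s
        using periodic[of "z1 + of_int q * s" q "z2 + of_int p * s + y" p] by (simp add: algebra_simps)
    qed (intro continuous_intros)
    then show ?thesis unfolding shift H_def .
  qed
  have H_near: "\<bar>H y - H 0\<bar> \<le> L / \<bar>of_int q\<bar>" for y
  proof -
    \<comment> \<open>Removing \<open>?k\<close> periods of length \<open>1 / q\<close> leaves a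
      translation smaller than \<open>1 / \<bar>q\<bar>\<close>, to which the Lipschitz bound
      applies.\<close>
    let ?k = "\<lfloor>y * of_int q\<rfloor>"
    have "H y = H (y - of_int ?k / of_int q)"
      using H_per[of "y - of_int ?k / of_int q" ?k] by simp
    then have "\<bar>H y - H 0\<bar> \<le> L * \<bar>y - of_int ?k / of_int q\<bar>"
      using H_lip[of "y - of_int ?k / of_int q" 0] by simp
    also have "y - of_int ?k / of_int q = frac (y * of_int q) / of_int q"
      using assms by (simp add: frac_def field_simps)
    also have "L * \<bar>frac (y * of_int q) / of_int q\<bar> \<le> L * (1 / \<bar>of_int q\<bar>)"
      using frac_lt_1[of "y * of_int q"] by (intro mult_left_mono L_nonneg) (simp add: divide_right_mono)
    finally show ?thesis by simp
  qed
  have H_cont: "continuous_on UNIV H"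
  proof -
    have "L-lipschitz_on UNIV H"
      by (rule lipschitz_onI) (use H_lip L_nonneg in \<open>auto simp: dist_real_def\<close>)
    then show ?thesis by (rule lipschitz_on_continuous_on)
  qed
  have H_mean: "integral {0..1} H = mean"
  proof -
    let ?G = "\<lambda>a. integral {0..1} (g a)"
    have G_cont: "continuous_on UNIV ?G"
    proof -
      have "L-lipschitz_on UNIV ?G"
      proof (rule lipschitz_onI)
        fix a a'
        have "?G a - ?G a' = integral {0..1} (\<lambda>b. g a b - g a' b)"
          by (intro integral_diff[symmetric] integrable_continuous_real continuous_intros)
        also have "\<bar>\<dots>\<bar> \<le> L * \<bar>a - a'\<bar> * (1 - 0)"
        proof (intro abs_integral_le continuous_intros)
          fix b show "\<bar>g a b - g a' b\<bar> \<le> L * \<bar>a - a'\<bar>" using lipschitz[of a b a' b] by simp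
        qed auto
        finally show "dist (?G a) (?G a') \<le> L * dist a a'" by (simp add: dist_real_def)
      qed (rule L_nonneg)
      then show ?thesis by (rule lipschitz_on_continuous_on)
    qed
    \<comment> \<open>After exchanging the integrals, the inner one runs over a full vertical circle
      and forgets \<open>z2\<close>; the outer one winds \<open>q\<close> times around the
      horizontal circle and forgets \<open>z1\<close>.\<close>
    have "integral {0..1} H =
        integral {0..1} (\<lambda>s. integral {0..1} (\<lambda>y. g (z1 + of_int q * s) (z2 + of_int p * s + y)))"
      using integral_swap_continuous[of 0 0 1 1 "\<lambda>y s. g (z1 + of_int q * s) (z2 + of_int p * s + y)"]
      unfolding H_def by (simp add: case_prod_beta continuous_intros)
    also have "\<dots> = integral {0..1} (\<lambda>s. ?G (z1 + of_int q * s))"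
    proof (rule integral_cong)
      fix s :: real
      have "integral {0..1} (\<lambda>y. g (z1 + of_int q * s) (y + (z2 + of_int p * s))) = ?G (z1 + of_int q * s)"
        by (rule integral_unit_shift)
          (use periodic[of _ 0 _ 1] in \<open>auto intro!: continuous_intros\<close>)
      then show "integral {0..1} (\<lambda>y. g (z1 + of_int q * s) (z2 + of_int p * s + y)) = ?G (z1 + of_int q * s)"
        by (simp add: add_ac)
    qed
    also have "\<dots> = mean" unfolding mean_def
    proof (rule integral_unit_scale[OF G_cont _ assms(1)])
      have "g (a + 1) = g a" for a
        using periodic[of a 1 _ 0] by (intro ext) simp
      then show "?G (a + 1) = ?G a" for a by simp
    qed
    finally show ?thesis .
  qed
  have "mean - H 0 = integral {0..1} (\<lambda>y. H y - H 0)"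
    using H_mean H_cont by (simp add: integral_diff integrable_continuous_real continuous_on_subset[of UNIV])
  also have "\<bar>\<dots>\<bar> \<le> L / \<bar>of_int q\<bar> * (1 - 0)"
    by (intro abs_integral_le continuous_intros continuous_on_subset[OF H_cont] H_near) auto
  finally show ?thesis unfolding H_def by (simp add: abs_minus_commute)
qed

end

subsection \<open>Near-periods and equidistribution\<close>

text \<open>The Diophantine index in coordinates, with the constant \<open>c\<close> made explicit
  and the sum norm in place of the Euclidean one.\<close>

definition dioph :: "real \<Rightarrow> real \<Rightarrow> real \<Rightarrow> real \<Rightarrow> bool" where
  "dioph v w \<sigma> c \<longleftrightarrow> 0 < \<sigma> \<and> 0 < c \<and>
     (\<forall>m n :: int. m \<noteq> 0 \<or> n \<noteq> 0 \<longrightarrow>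
        c * (\<bar>of_int m\<bar> + \<bar>of_int n\<bar>) powr (- \<sigma>) \<le> \<bar>of_int m * v + of_int n * w\<bar>)"

text \<open>The Euclidean norm is at most the sum norm and the exponent is negative, so the same
  constant serves.\<close>

lemma dioph_exists:
  assumes "diophantine_index \<xi> \<sigma>"
  obtains c where "dioph (\<xi> $ 1) (\<xi> $ 2) \<sigma> c"
proof -
  obtain C where C: "0 < \<sigma>" "0 < C"
    "\<And>k. k \<in> int_lattice - {0} \<Longrightarrow> C * norm k powr (- \<sigma>) \<le> \<bar>\<xi> \<bullet> k\<bar>"
    using assms unfolding diophantine_index_def by auto
  have "C * (\<bar>of_int m\<bar> + \<bar>of_int n\<bar>) powr (- \<sigma>) \<le> \<bar>of_int m * \<xi> $ 1 + of_int n * \<xi> $ 2\<bar>"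
    if mn: "m \<noteq> 0 \<or> n \<noteq> 0" for m n :: int
  proof -
    define k :: "real^2" where "k = vector [of_int m, of_int n]"
    have k12: "k $ 1 = of_int m" "k $ 2 = of_int n" by (simp_all add: k_def)
    then have "k \<noteq> 0" using mn by (metis of_int_eq_0_iff zero_index)
    moreover have "k \<in> int_lattice"
      unfolding int_lattice_def by (simp add: forall_2 k12)
    moreover have "norm k \<le> \<bar>of_int m\<bar> + \<bar>of_int n\<bar>"
      using norm_le_l1_cart[of k] by (simp add: sum_2 k12)
    moreover have "\<xi> \<bullet> k = of_int m * \<xi> $ 1 + of_int n * \<xi> $ 2"
      by (simp add: inner_vec_def sum_2 k12 mult.commute)
    moreover have "C * (\<bar>of_int m\<bar> + \<bar>of_int n\<bar>) powr (- \<sigma>) \<le> C * norm k powr (- \<sigma>)"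
      using C calculation by (intro mult_left_mono powr_mono2') auto
    ultimately show ?thesis using C(3)[of k] by simp
  qed
  with C that show ?thesis unfolding dioph_def by blast
qed

lemma dioph_nonzero: "dioph v w \<sigma> c \<Longrightarrow> v \<noteq> 0"
proof
  assume "dioph v w \<sigma> c" "v = 0"
  then have "0 < c" "c * (\<bar>of_int 1\<bar> + \<bar>of_int 0\<bar>) powr (- \<sigma>) \<le> \<bar>of_int 1 * v + of_int 0 * w\<bar>"
    unfolding dioph_def by (blast, metis zero_neq_one)
  then show False using \<open>v = 0\<close> by simp
qed

text \<open>Dirichlet approximation of the slope \<open>w / v\<close> gives a denominator
  \<open>k\<close> up to \<open>N\<close> with error below \<open>1 / N\<close>. The Diophantine
  condition at \<open>(- h, k)\<close> forbids so good an approximation with a small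
  \<open>k\<close>, hence the lower bound.\<close>

lemma dioph_near_period:
  assumes "dioph v w \<sigma> c"
  obtains c' where "0 < c'"
    "\<And>N :: nat. 0 < N \<Longrightarrow> \<exists>p q :: int. q \<noteq> 0 \<and> coprime p q \<and> \<bar>of_int q\<bar> \<le> real N \<and>
       c' * real N powr (1 / \<sigma>) \<le> \<bar>of_int q\<bar> \<and>
       \<bar>of_int q\<bar> / \<bar>v\<bar> * v = of_int q \<and> \<bar>\<bar>of_int q\<bar> / \<bar>v\<bar> * w - of_int p\<bar> \<le> 1 / real N"
proof -
  have v: "v \<noteq> 0" using dioph_nonzero assms .
  have \<sigma>: "0 < \<sigma>" and c: "0 < c"
    and D: "\<And>m n :: int. m \<noteq> 0 \<or> n \<noteq> 0 \<Longrightarrow>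
        c * (\<bar>of_int m\<bar> + \<bar>of_int n\<bar>) powr (- \<sigma>) \<le> \<bar>of_int m * v + of_int n * w\<bar>"
    using assms unfolding dioph_def by auto
  \<comment> \<open>\<open>A\<close> bounds the size of \<open>(- h, k)\<close> relative to
    \<open>k\<close>, since \<open>\<bar>h\<bar>\<close> is at most
    \<open>k * \<bar>w / v\<bar> + 1\<close> and \<open>k\<close> is at least 1.\<close>
  define A where "A = \<bar>w / v\<bar> + 2"
  define c' where "c' = (c / \<bar>v\<bar>) powr (1 / \<sigma>) / A"
  have A: "0 < A" by (simp add: A_def add_nonneg_pos)
  have c': "0 < c'" using c v A by (simp add: c'_def)
  show ?thesis
  proof (rule that[OF c'])
    fix N :: nat assume N: "0 < N"
    obtain h k where hk: "coprime h k" "0 < k" "k \<le> int N" "\<bar>of_int k * (w / v) - of_int h\<bar> < 1 / N"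
      by (rule Dirichlet_approx_coprime[OF N, of "w / v"])
    \<comment> \<open>The sign of \<open>v\<close> is moved into both \<open>p\<close> and
      \<open>q\<close>, so that the return time stays positive.\<close>
    define s :: int where "s = (if 0 < v then 1 else -1)"
    have s: "\<bar>v\<bar> = of_int s * v" "\<bar>of_int s :: real\<bar> = 1" "s * s = 1" using v by (auto simp: s_def)
    have k1: "1 \<le> (of_int k :: real)" using hk by simp
    have kN: "(of_int k :: real) \<le> real N" using hk(3) by (metis of_int_le_iff of_int_of_nat_eq)
    have absk: "\<bar>of_int (s * k)\<bar> = (of_int k :: real)" using s hk by (simp add: abs_mult)
    have inv: "1 / \<bar>v\<bar> = of_int s / v"
      using v by (auto simp: s_def)
    have "\<bar>of_int h :: real\<bar> \<le> of_int k * \<bar>w / v\<bar> + 1"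
    proof -
      have "1 / real N \<le> 1" using N by simp
      then have "\<bar>of_int k * (w / v) - of_int h\<bar> < 1" using hk(4) by linarith
      moreover have "\<bar>of_int k * (w / v)\<bar> = of_int k * \<bar>w / v\<bar>" using k1 by (simp add: abs_mult)
      moreover have "\<bar>x - y\<bar> < 1 \<Longrightarrow> \<bar>x\<bar> = z \<Longrightarrow> \<bar>y\<bar> \<le> z + 1" for x y z :: real by linarith
      ultimately show ?thesis by blast
    qed
    also have "\<dots> \<le> of_int k * \<bar>w / v\<bar> + of_int k" using k1 by simp
    finally have "\<bar>of_int (- h)\<bar> + \<bar>of_int k\<bar> \<le> of_int k * A"
      using k1 unfolding A_def by (simp add: algebra_simps)
    then have "c * (of_int k * A) powr (- \<sigma>) \<le> c * (\<bar>of_int (- h)\<bar> + \<bar>of_int k\<bar>) powr (- \<sigma>)"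
      using c \<sigma> k1 by (intro mult_left_mono powr_mono2') auto
    also have "\<dots> \<le> \<bar>of_int (- h) * v + of_int k * w\<bar>" using hk by (intro D) auto
    also have "of_int (- h) * v + of_int k * w = v * (of_int k * (w / v) - of_int h)"
      using v by (simp add: field_simps)
    also have "\<bar>\<dots>\<bar> \<le> \<bar>v\<bar> * (1 / N)" unfolding abs_mult using hk(4) by (intro mult_left_mono) auto
    finally have "c * (of_int k * A) powr (- \<sigma>) \<le> \<bar>v\<bar> / N" by simp
    then have "c / \<bar>v\<bar> * real N \<le> (of_int k * A) powr \<sigma>"
      using N v A k1 by (simp add: powr_minus field_simps)
    then have "(c / \<bar>v\<bar> * real N) powr (1 / \<sigma>) \<le> ((of_int k * A) powr \<sigma>) powr (1 / \<sigma>)"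
      using c \<sigma> by (intro powr_mono2) auto
    also have "\<dots> = of_int k * A" using \<sigma> A k1 by (simp add: powr_powr)
    finally have "c' * real N powr (1 / \<sigma>) \<le> of_int k"
      using A c v by (simp add: c'_def powr_mult powr_divide field_simps)
    moreover have "of_int k / \<bar>v\<bar> * w - of_int (s * h) = of_int s * (of_int k * (w / v) - of_int h)"
      using v by (simp add: s_def field_simps)
    then have "\<bar>of_int k / \<bar>v\<bar> * w - of_int (s * h)\<bar> \<le> 1 / N"
      using hk(4) s by (simp add: abs_mult)
    moreover have "of_int k / \<bar>v\<bar> * v = of_int (s * k)" using v by (simp add: s_def)
    moreover have "coprime (s * h) (s * k)" "s * k \<noteq> 0"
      using hk by (auto simp: s_def)
    ultimately show "\<exists>p q :: int. q \<noteq> 0 \<and> coprime p q \<and> \<bar>of_int q\<bar> \<le> real N \<and>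
       c' * real N powr (1 / \<sigma>) \<le> \<bar>of_int q\<bar> \<and>
       \<bar>of_int q\<bar> / \<bar>v\<bar> * v = of_int q \<and> \<bar>\<bar>of_int q\<bar> / \<bar>v\<bar> * w - of_int p\<bar> \<le> 1 / real N"
      using kN absk by (intro exI[of _ "s * h"] exI[of _ "s * k"]) (simp only: simp_thms)
  qed
qed

context lipschitz_torus
begin

text \<open>Rescaled to the unit interval, the flow over one near-period agrees with a closed line
  of direction \<open>(q, p)\<close> in the first coordinate and drifts by at most \<open>e\<close>
  in the second. The drift costs \<open>L * e\<close>, and the closed line costs
  \<open>L / \<bar>q\<bar>\<close>.\<close>

lemma block:
  fixes p q :: int
  assumes q: "q \<noteq> 0" "coprime p q" and P: "0 < P" "P * v = of_int q" "\<bar>P * w - of_int p\<bar> \<le> e"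
  shows "\<bar>integral {x0..x0 + P} (\<lambda>x. g (x * v) (x * w)) - P * mean\<bar> \<le> P * (L / \<bar>of_int q\<bar> + L * e)"
proof -
  let ?F = "\<lambda>x. g (x * v) (x * w)"
  have "(?F has_integral integral {x0..x0 + P} ?F) (cbox x0 (x0 + P))"
    unfolding cbox_interval
    by (intro integrable_integral integrable_continuous_real continuous_intros)
  from has_integral_affinity'[OF this P(1), of x0] P(1)
  have "((\<lambda>s. ?F (P * s + x0)) has_integral integral {x0..x0 + P} ?F / P) {0..1}"
    by (simp add: divide_inverse mult.commute)
  then have "integral {0..1} (\<lambda>s. ?F (P * s + x0)) = integral {x0..x0 + P} ?F / P"
    by (rule integral_unique)
  then have eq: "integral {x0..x0 + P} ?F = P * integral {0..1} (\<lambda>s. ?F (P * s + x0))"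
    using P(1) by simp
  let ?E = "\<lambda>s. g (x0 * v + of_int q * s) (x0 * w + of_int p * s)"
  have "integral {0..1} (\<lambda>s. ?F (P * s + x0)) - integral {0..1} ?E =
      integral {0..1} (\<lambda>s. ?F (P * s + x0) - ?E s)"
    by (intro integral_diff[symmetric] integrable_continuous_real continuous_intros)
  also have "\<bar>\<dots>\<bar> \<le> L * e * (1 - 0)"
  proof (intro abs_integral_le continuous_intros)
    fix s :: real assume s: "0 \<le> s" "s \<le> 1"
    have "\<bar>?F (P * s + x0) - ?E s\<bar> \<le>
        L * (\<bar>(P * s + x0) * v - (x0 * v + of_int q * s)\<bar> + \<bar>(P * s + x0) * w - (x0 * w + of_int p * s)\<bar>)"
      by (rule lipschitz)
    also have "(P * s + x0) * v - (x0 * v + of_int q * s) = 0"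
      unfolding P(2)[symmetric] by (simp add: algebra_simps)
    also have "(P * s + x0) * w - (x0 * w + of_int p * s) = s * (P * w - of_int p)"
      by (simp add: algebra_simps)
    also have "\<bar>0\<bar> + \<bar>s * (P * w - of_int p)\<bar> \<le> 1 * e"
      unfolding abs_zero add_0 abs_mult using s P(3) by (intro mult_mono) auto
    finally show "\<bar>?F (P * s + x0) - ?E s\<bar> \<le> L * e"
      using L_nonneg by (simp add: mult_left_mono)
  qed simp
  finally have "\<bar>integral {0..1} (\<lambda>s. ?F (P * s + x0)) - integral {0..1} ?E\<bar> \<le> L * e" by simp
  then have "\<bar>integral {0..1} (\<lambda>s. ?F (P * s + x0)) - mean\<bar> \<le> L / \<bar>of_int q\<bar> + L * e"
    using closed_line[OF q, of "x0 * v" "x0 * w"] by linarith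
  then have "P * \<bar>integral {0..1} (\<lambda>s. ?F (P * s + x0)) - mean\<bar> \<le> P * (L / \<bar>of_int q\<bar> + L * e)"
    using P(1) by (intro mult_left_mono) auto
  also have "P * \<bar>integral {0..1} (\<lambda>s. ?F (P * s + x0)) - mean\<bar> = \<bar>integral {x0..x0 + P} ?F - P * mean\<bar>"
    unfolding eq using P(1) by (simp add: abs_mult flip: right_diff_distrib)
  finally show ?thesis .
qed

text \<open>The interval is cut into \<open>nat \<lfloor>T / P\<rfloor>\<close> near-periods and a
  remainder of length at most \<open>P\<close>. The remainder and its share of the mean cost
  \<open>P * M\<close> each.\<close>

lemma flow_integral:
  fixes p q :: int
  assumes q: "q \<noteq> 0" "coprime p q" and P: "0 < P" "P * v = of_int q" "\<bar>P * w - of_int p\<bar> \<le> e"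
    and M: "\<And>a b. \<bar>g a b\<bar> \<le> M" and T: "0 \<le> T"
  shows "\<bar>integral {0..T} (\<lambda>x. g (x * v) (x * w)) - T * mean\<bar> \<le> T * (L / \<bar>of_int q\<bar> + L * e) + 2 * P * M"
proof -
  let ?F = "\<lambda>x. g (x * v) (x * w)" and ?E = "L / \<bar>of_int q\<bar> + L * e"
  have int: "?F integrable_on {a..b}" for a b
    by (intro integrable_continuous_real continuous_intros)
  have E: "0 \<le> ?E" using L_nonneg P(3) by (intro add_nonneg_nonneg mult_nonneg_nonneg) auto
  have blocks: "\<bar>integral {0..real n * P} ?F - real n * P * mean\<bar> \<le> real n * P * ?E" for n
  proof (induction n)
    case (Suc n)
    have "integral {0..real (Suc n) * P} ?F =
        integral {0..real n * P} ?F + integral {real n * P..real (Suc n) * P} ?F"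
      using P(1) by (intro Henstock_Kurzweil_Integration.integral_combine[symmetric] int) auto
    moreover have "real (Suc n) * P = real n * P + P" by (simp add: algebra_simps)
    ultimately show ?case
      using Suc block[OF q P, of "real n * P"] by (simp add: algebra_simps)
  qed simp
  have mean: "\<bar>mean\<bar> \<le> M"
  proof -
    have "\<bar>integral {0..1} (g a)\<bar> \<le> M * (1 - 0)" for a
      by (intro abs_integral_le continuous_intros M) auto
    moreover have "continuous_on {0..1} (\<lambda>a. integral {0..1} (g a))"
      using integral_continuous_on_param[of "{0..1}" 0 1 g] by (simp add: case_prod_beta continuous_intros)
    ultimately have "\<bar>mean\<bar> \<le> M * (1 - 0)" unfolding mean_def
      by (intro abs_integral_le) auto
    then show ?thesis by simp
  qed
  define n where "n = nat \<lfloor>T / P\<rfloor>"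
  have "real n \<le> T / P" "T / P < real n + 1"
    using T P(1) by (auto simp: n_def)
  then have n: "real n * P \<le> T" "T - real n * P \<le> P"
    using P(1) by (auto simp: field_simps)
  have split: "integral {0..T} ?F = integral {0..real n * P} ?F + integral {real n * P..T} ?F"
    using n P(1) by (intro Henstock_Kurzweil_Integration.integral_combine[symmetric] int) auto
  have "\<bar>integral {real n * P..T} ?F\<bar> \<le> M * (T - real n * P)"
    using n by (intro abs_integral_le continuous_intros M) auto
  moreover have "\<bar>(T - real n * P) * mean\<bar> \<le> (T - real n * P) * M"
    using n mean by (simp add: abs_mult mult_left_mono)
  moreover have "(T - real n * P) * M \<le> P * M"
    using n mean by (intro mult_right_mono) auto
  moreover have "real n * P * ?E \<le> T * ?E" using n E by (intro mult_right_mono)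
  moreover have "T * mean = real n * P * mean + (T - real n * P) * mean" by (simp add: algebra_simps)
  moreover have "M * (T - real n * P) = (T - real n * P) * M" by (rule mult.commute)
  ultimately show ?thesis
    using blocks[of n] split by linarith
qed

end

text \<open>For index 1, \<open>q\<close> is comparable to \<open>N\<close>. With \<open>N\<close>
  of order \<open>sqrt T\<close>, the closed-line error, the drift and the remainder divided by
  \<open>T\<close> are all of order \<open>1 / sqrt T\<close>. \<open>K\<close> is uniform in
  \<open>g\<close>, so \<open>g\<close> may later depend on \<open>T\<close>.\<close>

lemma equidistribution:
  assumes "dioph v w 1 c"
  obtains K where "0 < K"
    "\<And>g L M T. \<lbrakk>lipschitz_torus g L; \<And>a b. \<bar>g a b\<bar> \<le> M; 1 \<le> T\<rbrakk> \<Longrightarrow>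
       \<bar>1 / T * integral {0..T} (\<lambda>x. g (x * v) (x * w)) - lipschitz_torus.mean g\<bar> \<le> K * (L + M) / sqrt T"
proof -
  obtain c' where c': "0 < c'"
    and near: "\<And>N :: nat. 0 < N \<Longrightarrow> \<exists>p q :: int. q \<noteq> 0 \<and> coprime p q \<and> \<bar>of_int q\<bar> \<le> real N \<and>
       c' * real N powr (1 / 1) \<le> \<bar>of_int q\<bar> \<and>
       \<bar>of_int q\<bar> / \<bar>v\<bar> * v = of_int q \<and> \<bar>\<bar>of_int q\<bar> / \<bar>v\<bar> * w - of_int p\<bar> \<le> 1 / real N"
    using dioph_near_period[OF assms] by metis
  have v: "v \<noteq> 0" using dioph_nonzero assms .
  define K where "K = 1 / c' + 1 + 4 / \<bar>v\<bar>"
  have K: "0 < K" using c' by (simp add: K_def add_pos_nonneg)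
  show ?thesis
  proof (rule that[OF K])
    fix g L M and T :: real
    assume g: "lipschitz_torus g L" and M: "\<And>a b. \<bar>g a b\<bar> \<le> M" and T: "1 \<le> T"
    interpret lipschitz_torus g L by (rule g)
    have M0: "0 \<le> M" using M[of 0 0] by linarith
    define N where "N = nat \<lceil>sqrt T\<rceil>"
    have sT: "1 \<le> sqrt T" using T by simp
    have N: "sqrt T \<le> real N" "real N \<le> 2 * sqrt T" "0 < N"
      using sT unfolding N_def by linarith+
    obtain p q :: int where q: "q \<noteq> 0" "coprime p q" and qN: "\<bar>of_int q\<bar> \<le> real N"
      and qc: "c' * real N \<le> \<bar>of_int q\<bar>"
      and P: "\<bar>of_int q\<bar> / \<bar>v\<bar> * v = of_int q" "\<bar>\<bar>of_int q\<bar> / \<bar>v\<bar> * w - of_int p\<bar> \<le> 1 / real N"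
      using near[OF N(3)] by auto
    let ?P = "\<bar>of_int q\<bar> / \<bar>v\<bar>"
    have P0: "0 < ?P" using q v by simp
    have q1: "1 / \<bar>of_int q\<bar> \<le> 1 / (c' * sqrt T)"
    proof (rule divide_left_mono)
      show "c' * sqrt T \<le> \<bar>of_int q\<bar>" using qc c' N(1) by (meson mult_left_mono less_imp_le order_trans)
    qed (use c' sT q in auto)
    have N1: "1 / real N \<le> 1 / sqrt T"
      by (rule divide_left_mono[OF N(1)]) (use N(3) sT in simp_all)
    have P1: "?P \<le> 2 * sqrt T / \<bar>v\<bar>" using qN N by (intro divide_right_mono) auto
    have "\<bar>integral {0..T} (\<lambda>x. g (x * v) (x * w)) - T * mean\<bar>
        \<le> T * (L / \<bar>of_int q\<bar> + L * (1 / real N)) + 2 * ?P * M"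
      by (rule flow_integral[OF q P0 P M]) (use T in auto)
    also have "\<dots> = T * (L * (1 / \<bar>of_int q\<bar>) + L * (1 / real N)) + 2 * ?P * M" by simp
    also have "\<dots> \<le> T * (L * (1 / (c' * sqrt T)) + L * (1 / sqrt T)) + 2 * (2 * sqrt T / \<bar>v\<bar>) * M"
      using T by (intro add_mono mult_left_mono mult_right_mono q1 N1 P1 L_nonneg M0) auto
    also have "\<dots> = T * (1 / c' * L + L + 4 / \<bar>v\<bar> * M) / sqrt T"
      using sT c' v real_sqrt_mult_self[of T] T by (simp add: field_simps)
    also have "\<dots> \<le> T * (K * (L + M)) / sqrt T"
    proof (intro divide_right_mono mult_left_mono)
      have "K * (L + M) = (1 / c' * L + L + 4 / \<bar>v\<bar> * M) + (4 / \<bar>v\<bar> * L + (1 / c' + 1) * M)"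
        unfolding K_def by (simp add: algebra_simps add_divide_distrib)
      moreover have "0 \<le> 4 / \<bar>v\<bar> * L + (1 / c' + 1) * M"
        using L_nonneg M0 c' by simp
      ultimately show "1 / c' * L + L + 4 / \<bar>v\<bar> * M \<le> K * (L + M)" by linarith
    qed (use T in auto)
    finally have *: "\<bar>integral {0..T} (\<lambda>x. g (x * v) (x * w)) - T * mean\<bar> \<le> T * (K * (L + M)) / sqrt T" .
    have "\<bar>1 / T * integral {0..T} (\<lambda>x. g (x * v) (x * w)) - mean\<bar>
        = \<bar>1 / T * (integral {0..T} (\<lambda>x. g (x * v) (x * w)) - T * mean)\<bar>"
      using T by (simp add: right_diff_distrib)
    also have "\<dots> = 1 / T * \<bar>integral {0..T} (\<lambda>x. g (x * v) (x * w)) - T * mean\<bar>"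
      using T by (simp add: abs_mult)
    also have "\<dots> \<le> 1 / T * (T * (K * (L + M)) / sqrt T)"
      using * T by (intro mult_left_mono) auto
    also have "\<dots> = K * (L + M) / sqrt T" using T by simp
    finally show "\<bar>1 / T * integral {0..T} (\<lambda>x. g (x * v) (x * w)) - mean\<bar> \<le> K * (L + M) / sqrt T" .
  qed
qed

subsection \<open>Time spent near the singularity\<close>

text \<open>Eliminating the time \<open>x\<close> from the two coordinates near
  \<open>(1/4 + m, 1/4 + n)\<close> and clearing the denominator 4 gives a small combination of
  \<open>v\<close> and \<open>w\<close> with odd, hence nonzero, coefficients. For index 1 this
  excludes visits before a time of order \<open>1 / d\<close>.\<close>

lemma line_near_singularity:
  assumes "dioph v w \<sigma> c" "1 \<le> T" "0 \<le> x" "x \<le> T" "d \<le> 1" "rho (x * v) (x * w) < d"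
  shows "c * (4 * T * (\<bar>v\<bar> + \<bar>w\<bar> + 2)) powr (- \<sigma>) \<le> 4 * d * (\<bar>v\<bar> + \<bar>w\<bar>)"
proof -
  obtain m n :: int where mn: "\<bar>x * v - 1/4 - of_int m\<bar> < d" "\<bar>x * w - 1/4 - of_int n\<bar> < d"
    using rho_less_near[OF assms(6)] by blast
  have \<sigma>: "0 < \<sigma>" "0 < c" using assms(1) by (auto simp: dioph_def)
  let ?k = "1 + 4 * n" and ?l = "- (1 + 4 * m)"
  have "?k \<noteq> 0" by presburger
  then have D: "c * (\<bar>of_int ?k\<bar> + \<bar>of_int ?l\<bar>) powr (- \<sigma>) \<le> \<bar>of_int ?k * v + of_int ?l * w\<bar>"
    using assms(1) unfolding dioph_def by blast
  have xv: "\<bar>x * v\<bar> \<le> T * \<bar>v\<bar>" "\<bar>x * w\<bar> \<le> T * \<bar>w\<bar>"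
    using assms by (simp_all add: abs_mult mult_right_mono)
  have "\<bar>of_int ?k\<bar> + \<bar>of_int ?l\<bar> \<le> 4 * (T * \<bar>v\<bar> + T * \<bar>w\<bar> + 2 * d)"
    using mn xv by simp linarith
  also have "\<dots> \<le> 4 * T * (\<bar>v\<bar> + \<bar>w\<bar> + 2)"
    using assms by (simp add: algebra_simps)
  finally have "c * (4 * T * (\<bar>v\<bar> + \<bar>w\<bar> + 2)) powr (- \<sigma>) \<le> c * (\<bar>of_int ?k\<bar> + \<bar>of_int ?l\<bar>) powr (- \<sigma>)"
    using \<sigma> \<open>?k \<noteq> 0\<close> by (intro mult_left_mono powr_mono2') (auto simp del: of_int_add of_int_mult intro: add_pos_nonneg)
  also note D
  also have "of_int ?k * v + of_int ?l * w =
      4 * ((x * v - 1/4 - of_int m) * w - (x * w - 1/4 - of_int n) * v)"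
    by (simp add: algebra_simps)
  also have "\<bar>\<dots>\<bar> \<le> 4 * (d * \<bar>w\<bar> + d * \<bar>v\<bar>)"
  proof -
    have "\<bar>(x * v - 1/4 - of_int m) * w\<bar> \<le> d * \<bar>w\<bar>" "\<bar>(x * w - 1/4 - of_int n) * v\<bar> \<le> d * \<bar>v\<bar>"
      unfolding abs_mult using mn by (intro mult_right_mono; simp)+
    moreover have "\<lbrakk>\<bar>a\<bar> \<le> s; \<bar>b\<bar> \<le> t\<rbrakk> \<Longrightarrow> \<bar>4 * (a - b)\<bar> \<le> 4 * (s + t)" for a b s t :: real
      using abs_triangle_ineq4[of a b] by (simp add: abs_mult)
    ultimately show ?thesis by blast
  qed
  also have "\<dots> = 4 * d * (\<bar>v\<bar> + \<bar>w\<bar>)" by (simp add: algebra_simps)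
  finally show ?thesis .
qed

text \<open>The same elimination with exact equalities gives a vanishing integer combination with
  odd coefficients. Thus the integrand is continuous along the line.\<close>

lemma rho_line_pos:
  assumes "dioph v w \<sigma> c"
  shows "0 < rho (x * v) (x * w)"
proof (rule ccontr)
  assume "\<not> ?thesis"
  then have "rho (x * v) (x * w) = 0" using rho_nonneg[of "x * v" "x * w"] by linarith
  then obtain m n :: int where xv: "x * v = 1/4 + of_int m" "x * w = 1/4 + of_int n"
    by (rule rho_zeroE)
  let ?k = "1 + 4 * n" and ?l = "- (1 + 4 * m)"
  have k: "?k \<noteq> 0" by presburger
  then have "c * (\<bar>of_int ?k\<bar> + \<bar>of_int ?l\<bar>) powr (- \<sigma>) \<le> \<bar>of_int ?k * v + of_int ?l * w\<bar>"
    using assms unfolding dioph_def by blast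
  also have "of_int ?k * v + of_int ?l * w = 4 * ((1/4 + of_int n) * v - (1/4 + of_int m) * w)"
    by (simp add: algebra_simps)
  also have "\<dots> = 0" unfolding xv[symmetric] by simp
  finally show False
    using assms k unfolding dioph_def
    by (smt (verit) of_int_eq_0_iff powr_gt_zero mult_pos_pos)
qed

text \<open>Two distinct visits differ by an almost integral vector which is almost parallel to \<open>(v, w)\<close>;
  the Diophantine condition makes it long.\<close>

lemma line_near_twice:
  assumes D: "dioph v w 1 c" and "rho (x * v) (x * w) < d" "rho (y * v) (y * w) < d"
    and far: "2 * d / \<bar>v\<bar> < \<bar>y - x\<bar>"
  shows "c \<le> 2 * d * (\<bar>v\<bar> + \<bar>w\<bar>) * (\<bar>y - x\<bar> * (\<bar>v\<bar> + \<bar>w\<bar>) + 4 * d)"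
proof -
  obtain m n :: int where mn: "\<bar>x * v - 1/4 - of_int m\<bar> < d" "\<bar>x * w - 1/4 - of_int n\<bar> < d"
    using rho_less_near assms(2) by blast
  obtain m' n' :: int where mn': "\<bar>y * v - 1/4 - of_int m'\<bar> < d" "\<bar>y * w - 1/4 - of_int n'\<bar> < d"
    using rho_less_near assms(3) by blast
  define k l where "k = m' - m" and "l = n' - n"
  define a b where "a = of_int k - (y - x) * v" and "b = of_int l - (y - x) * w"
  have ab: "\<bar>a\<bar> \<le> 2 * d" "\<bar>b\<bar> \<le> 2 * d"
    using mn mn' unfolding a_def b_def k_def l_def by (simp_all add: left_diff_distrib)
  have v: "v \<noteq> 0" using dioph_nonzero D .
  \<comment> \<open>Times further apart than \<open>2 * d / \<bar>v\<bar>\<close> move the first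
    coordinate by more than \<open>2 * d\<close>, so the two visits cannot share the integer
    \<open>m\<close>.\<close>
  have "k \<noteq> 0"
  proof
    assume "k = 0"
    then have "\<bar>y - x\<bar> * \<bar>v\<bar> \<le> 2 * d" using ab(1) by (simp add: a_def abs_mult)
    then show False using far v by (simp add: field_simps)
  qed
  then have "c * (\<bar>of_int l\<bar> + \<bar>of_int (- k)\<bar>) powr (- 1) \<le> \<bar>of_int l * v + of_int (- k) * w\<bar>"
    using D unfolding dioph_def by (metis neg_equal_0_iff_equal)
  also have "of_int l * v + of_int (- k) * w = b * v - a * w"
    by (simp add: a_def b_def algebra_simps)
  also have "\<bar>\<dots>\<bar> \<le> 2 * d * \<bar>v\<bar> + 2 * d * \<bar>w\<bar>"
  proof -
    have "\<bar>b * v\<bar> \<le> 2 * d * \<bar>v\<bar>" "\<bar>a * w\<bar> \<le> 2 * d * \<bar>w\<bar>"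
      unfolding abs_mult using ab by (intro mult_right_mono; simp)+
    then show ?thesis by linarith
  qed
  finally have "c / (\<bar>of_int l\<bar> + \<bar>of_int k\<bar>) \<le> 2 * d * (\<bar>v\<bar> + \<bar>w\<bar>)"
    by (simp add: powr_minus_divide algebra_simps)
  moreover have "0 < \<bar>of_int l\<bar> + \<bar>of_int k :: real\<bar>" using \<open>k \<noteq> 0\<close> by simp
  ultimately have "c \<le> 2 * d * (\<bar>v\<bar> + \<bar>w\<bar>) * (\<bar>of_int l\<bar> + \<bar>of_int k\<bar>)"
    by (simp add: pos_divide_le_eq)
  also have "\<dots> \<le> 2 * d * (\<bar>v\<bar> + \<bar>w\<bar>) * (\<bar>y - x\<bar> * (\<bar>v\<bar> + \<bar>w\<bar>) + 4 * d)"
  proof (rule mult_left_mono)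
    have "\<bar>of_int k\<bar> \<le> \<bar>(y - x) * v\<bar> + 2 * d" "\<bar>of_int l\<bar> \<le> \<bar>(y - x) * w\<bar> + 2 * d"
      using ab by (simp_all add: a_def b_def)
    then show "\<bar>of_int l\<bar> + \<bar>of_int k\<bar> \<le> \<bar>y - x\<bar> * (\<bar>v\<bar> + \<bar>w\<bar>) + 4 * d"
      unfolding abs_mult distrib_left by simp
    show "0 \<le> 2 * d * (\<bar>v\<bar> + \<bar>w\<bar>)" using ab by simp
  qed
  finally show ?thesis .
qed

text \<open>For small \<open>d\<close>, visits within one time interval of length \<open>l\<close>,
  of order \<open>1 / d\<close>, lie within \<open>D\<close>, of order \<open>d\<close>, of each
  other. About \<open>T / l\<close> such intervals give total time of order
  \<open>T * d\<^sup>2\<close>; the interval added by rounding up is absorbed because any visit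
  forces \<open>T * d\<close> to be at least \<open>c1\<close>.\<close>

lemma line_hits:
  assumes "dioph v w 1 c"
  obtains A where "0 < A"
    "\<And>T d. \<lbrakk>1 \<le> T; 0 < d; d \<le> 1\<rbrakk> \<Longrightarrow>
       emeasure lborel {x \<in> {0..T}. rho (x * v) (x * w) < d} \<le> ennreal (A * T * d\<^sup>2)"
proof -
  have v: "v \<noteq> 0" using dioph_nonzero assms .
  have c: "0 < c" using assms by (simp add: dioph_def)
  define N where "N = \<bar>v\<bar> + \<bar>w\<bar>"
  have N: "0 < N" using v by (simp add: N_def add_pos_nonneg)
  define c1 where "c1 = c / (16 * N * (N + 2))"
  have c1: "0 < c1" using c N by (simp add: c1_def)
  \<comment> \<open>The first summand covers large \<open>d\<close>, where the whole length
    \<open>T\<close> is already a good enough bound; the second comes from counting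
    intervals.\<close>
  define A where "A = 16 * N / c + (8 * N\<^sup>2 / c + 1 / c1) * (4 / \<bar>v\<bar>)"
  have A: "16 * N / c \<le> A" "(8 * N\<^sup>2 / c + 1 / c1) * (4 / \<bar>v\<bar>) \<le> A" "0 < A"
    using N c c1 v by (auto simp: A_def intro!: add_pos_nonneg)
  show ?thesis
  proof (rule that[OF A(3)])
    fix T d :: real
    assume T: "1 \<le> T" and d: "0 < d" "d \<le> 1"
    let ?S = "{x \<in> {0..T}. rho (x * v) (x * w) < d}"
    show "emeasure lborel ?S \<le> ennreal (A * T * d\<^sup>2)"
    proof (cases "c \<le> 16 * N * d\<^sup>2")
      case True
      have "emeasure lborel ?S \<le> emeasure lborel {0..T}" by (intro emeasure_mono) auto
      also have "\<dots> = ennreal T" using T by simp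
      also have "T * 1 \<le> T * (16 * N / c * d\<^sup>2)"
        using True c T by (intro mult_left_mono) (auto simp: field_simps)
      then have "ennreal T \<le> ennreal (16 * N / c * (T * d\<^sup>2))"
        by (intro ennreal_leI) (simp add: mult_ac)
      also have "\<dots> \<le> ennreal (A * (T * d\<^sup>2))"
        using A(1) T by (intro ennreal_leI mult_right_mono) auto
      finally show ?thesis by (simp add: mult_ac)
    next
      case False
      show ?thesis
      proof (cases "?S = {}")
        case True
        show ?thesis unfolding True by simp
      next
        case nonempty: False
        then obtain x where x: "0 \<le> x" "x \<le> T" "rho (x * v) (x * w) < d" by auto
        have "c * (4 * T * (N + 2)) powr (- 1) \<le> 4 * d * N"
          using line_near_singularity[OF assms T x(1,2) d(2) x(3)] by (simp add: N_def)
        then have "c \<le> 4 * d * N * (4 * T * (N + 2))"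
          using T N by (simp add: powr_minus_divide pos_divide_le_eq)
        then have Td: "c1 \<le> T * d" using N by (simp add: c1_def pos_divide_le_eq mult_ac)
        \<comment> \<open>With gap at most \<open>l\<close>, the bound for two separated visits
          becomes \<open>c / 4 + 8 * N * d\<^sup>2\<close>, which is below \<open>c\<close> in the
          present case.\<close>
        define l where "l = c / (8 * d * N\<^sup>2)"
        have l: "0 < l" using c d N by (simp add: l_def)
        define D where "D = 2 * d / \<bar>v\<bar>"
        have D: "0 < D" using d v by (simp add: D_def)
        have close: "\<bar>y - x\<bar> \<le> D" if "x \<in> ?S" "y \<in> ?S" "\<bar>y - x\<bar> \<le> l" for x y
        proof (rule ccontr)
          assume "\<not> \<bar>y - x\<bar> \<le> D"
          then have "c \<le> 2 * d * N * (\<bar>y - x\<bar> * N + 4 * d)"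
            using line_near_twice[OF assms, of x d y] that by (simp add: D_def N_def)
          also have "\<dots> \<le> 2 * d * N * (l * N + 4 * d)"
            using that(3) d N by (intro mult_left_mono add_right_mono mult_right_mono) auto
          also have "\<dots> = c / 4 + 8 * N * d\<^sup>2"
            using d N by (simp add: l_def power2_eq_square field_simps)
          also have "\<dots> < c" using False c by linarith
          finally show False by simp
        qed
        define n where "n = nat \<lceil>T / l\<rceil>"
        have n: "T / l \<le> real n" "real n \<le> T / l + 1"
          using T l unfolding n_def by (auto simp: le_of_int_ceiling)
        define B where "B i = ?S \<inter> {real i * l..real i * l + l}" for i
        \<comment> \<open>An interval around one chosen visit contains all visits in
          \<open>B i\<close>. If \<open>B i\<close> is empty the choice is arbitrary, which does no
          harm, since \<open>J i\<close> still has length \<open>2 * D\<close>.\<close>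
        define J where "J i = (let y = SOME y. y \<in> B i in {y - D..y + D})" for i
        have cover: "?S \<subseteq> (\<Union>i<n. J i)"
        proof
          fix y assume y: "y \<in> ?S"
          \<comment> \<open>The minimum treats the endpoint \<open>y = real n * l\<close>, which
            belongs to the last closed interval.\<close>
          define i where "i = min (nat \<lfloor>y / l\<rfloor>) (n - 1)"
          have n0: "0 < n"
          proof (rule ccontr)
            assume "\<not> 0 < n"
            then have "T / l \<le> 0" using n(1) by simp
            then show False using T l by (simp add: divide_le_0_iff)
          qed
          have yl: "y / l \<le> real n"
            using y l n(1) by (auto intro: order_trans[OF divide_right_mono])
          have f: "real (nat \<lfloor>y / l\<rfloor>) \<le> y / l" "y / l < real (nat \<lfloor>y / l\<rfloor>) + 1"
            using y l by auto
          have "real i \<le> y / l \<and> y / l \<le> real i + 1"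
          proof (cases "nat \<lfloor>y / l\<rfloor> \<le> n - 1")
            case True
            then show ?thesis using f by (simp add: i_def)
          next
            case False
            then have "i = n - 1" by (simp add: i_def)
            then show ?thesis using f yl n0 False by (simp add: of_nat_diff)
          qed
          then have yB: "y \<in> B i"
            using y l unfolding B_def by (auto simp: field_simps)
          then have z: "(SOME z. z \<in> B i) \<in> B i" by (rule someI)
          then have "\<bar>y - (SOME z. z \<in> B i)\<bar> \<le> l" using yB unfolding B_def by auto
          then have "\<bar>y - (SOME z. z \<in> B i)\<bar> \<le> D" using close z y unfolding B_def by auto
          then have "y \<in> J i" unfolding J_def Let_def by auto
          moreover have "i < n" using n0 by (simp add: i_def min_def) linarith
          ultimately show "y \<in> (\<Union>i<n. J i)" by blast
        qed
        have "emeasure lborel ?S \<le> emeasure lborel (\<Union>i<n. J i)"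
          by (intro emeasure_mono cover sets.finite_UN) (auto simp: J_def Let_def)
        also have "\<dots> \<le> (\<Sum>i<n. emeasure lborel (J i))"
          by (intro emeasure_subadditive_finite) (auto simp: J_def Let_def)
        also have "\<dots> = (\<Sum>i<n. ennreal (2 * D))"
          using D by (intro sum.cong) (auto simp: J_def Let_def)
        also have "\<dots> = ennreal (real n * (2 * D))"
          using D by (simp add: ennreal_mult ennreal_of_nat_eq_real_of_nat)
        also have "\<dots> \<le> ennreal (A * T * d\<^sup>2)"
        proof (rule ennreal_leI)
          have "1 \<le> T * d / c1" using Td c1 by (simp add: pos_le_divide_eq)
          then have "real n \<le> T / l + T * d / c1" using n(2) by linarith
          also have "\<dots> = (8 * N\<^sup>2 / c + 1 / c1) * (T * d)"
            using d c N c1 by (simp add: l_def field_simps)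
          finally have "real n * (2 * D) \<le> (8 * N\<^sup>2 / c + 1 / c1) * (T * d) * (2 * D)"
            using D by (intro mult_right_mono) auto
          also have "\<dots> = (8 * N\<^sup>2 / c + 1 / c1) * (4 / \<bar>v\<bar>) * (T * d\<^sup>2)"
            by (simp add: D_def power2_eq_square)
          also have "\<dots> \<le> A * (T * d\<^sup>2)"
            using A(2) T by (intro mult_right_mono) auto
          finally show "real n * (2 * D) \<le> A * T * d\<^sup>2" by (simp add: mult_ac)
        qed
        finally show ?thesis .
      qed
    qed
  qed
qed

text \<open>Squares of side \<open>2 * d\<close> around the nine singular points with
  \<open>m\<close> and \<open>n\<close> in \<open>{-1, 0, 1}\<close> cover the set, whence the
  constant \<open>9 * 4\<close>.\<close>

lemma cell_hits:
  assumes "0 < d" "d \<le> 1"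
  shows "emeasure lborel {x \<in> torus_cell. rho (x $ 1) (x $ 2) < d} \<le> ennreal (36 * d\<^sup>2)"
proof -
  define J :: "int \<times> int \<Rightarrow> (real^2) set" where "J = (\<lambda>(m, n).
    cbox (vector [1/4 + of_int m - d, 1/4 + of_int n - d]) (vector [1/4 + of_int m + d, 1/4 + of_int n + d]))"
  have J: "emeasure lborel (J mn) = ennreal (4 * d\<^sup>2)" for mn
  proof -
    obtain m n where mn: "mn = (m, n)" by (cases mn)
    have ne: "J mn \<noteq> {}"
      using assms by (auto simp: J_def mn interval_ne_empty_cart forall_2)
    have "emeasure lborel (J mn) = ennreal (measure lborel (J mn))"
      unfolding J_def mn prod.case by (intro emeasure_eq_ennreal_measure) (simp add: emeasure_lborel_cbox_eq)
    also have "measure lborel (J mn) = 4 * d\<^sup>2"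
      using ne content_cbox_cart[of "vector [1/4 + of_int m - d, 1/4 + of_int n - d] :: real^2"]
      by (simp add: J_def mn prod_2 UNIV_2 power2_eq_square)
    finally show ?thesis .
  qed
  have "{x \<in> torus_cell. rho (x $ 1) (x $ 2) < d} \<subseteq> (\<Union>mn\<in>{-1,0,1}\<times>{-1,0,1}. J mn)"
  proof
    fix x :: "real^2" assume x: "x \<in> {x \<in> torus_cell. rho (x $ 1) (x $ 2) < d}"
    then obtain m n :: int where mn: "\<bar>x $ 1 - 1/4 - of_int m\<bar> < d" "\<bar>x $ 2 - 1/4 - of_int n\<bar> < d"
      using rho_less_near by blast
    have range: "k \<in> {-1, 0, 1}" if "\<bar>a - 1/4 - of_int k\<bar> < d" "0 \<le> a" "a \<le> 1" for a and k :: int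
    proof -
      have "(-2::real) < of_int k" "of_int k < (2::real)" using that assms by linarith+
      then have "-2 < k" "k < 2" by linarith+
      then show ?thesis by auto
    qed
    have "0 \<le> x $ 1" "x $ 1 \<le> 1" "0 \<le> x $ 2" "x $ 2 \<le> 1"
      using x by (auto simp: torus_cell_def)
    then have "m \<in> {-1, 0, 1}" "n \<in> {-1, 0, 1}"
      using range[OF mn(1)] range[OF mn(2)] by blast+
    moreover have "x \<in> J (m, n)"
      using mn by (auto simp: J_def mem_box_cart forall_2)
    ultimately show "x \<in> (\<Union>mn\<in>{-1,0,1}\<times>{-1,0,1}. J mn)" by blast
  qed
  then have "emeasure lborel {x \<in> torus_cell. rho (x $ 1) (x $ 2) < d}
      \<le> emeasure lborel (\<Union>mn\<in>{-1,0,1}\<times>{-1,0,1}. J mn)"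
    by (intro emeasure_mono sets.finite_UN) (auto simp: J_def)
  also have "\<dots> \<le> (\<Sum>mn\<in>{-1,0,1}\<times>{-1,0,1}. emeasure lborel (J mn))"
    by (intro emeasure_subadditive_finite) (auto simp: J_def)
  also have "\<dots> = (\<Sum>mn\<in>{-1,0,1::int}\<times>{-1,0,1::int}. ennreal (4 * d\<^sup>2))"
    by (intro sum.cong J) simp
  also have "\<dots> = of_nat 9 * ennreal (4 * d\<^sup>2)"
    by (simp only: sum_constant card_cartesian_product) simp
  also have "\<dots> = ennreal (36 * d\<^sup>2)"
    unfolding ennreal_of_nat_eq_real_of_nat by (subst ennreal_mult[symmetric]) auto
  finally show ?thesis .
qed

subsection \<open>Truncation of the singularity\<close>

text \<open>Dyadic decomposition of \<open>{R < r}\<close>. At \<open>R x = 0\<close> the integrand is the junk value 0.\<close>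

lemma nn_integral_neg_powr:
  fixes R :: "'a \<Rightarrow> real"
  assumes [measurable]: "R \<in> borel_measurable M" and R: "\<And>x. 0 \<le> R x"
    and \<gamma>: "\<gamma> < 2" and r: "0 < r" and A: "0 \<le> A"
    and bound: "\<And>d. \<lbrakk>0 < d; d \<le> r\<rbrakk> \<Longrightarrow> emeasure M {x \<in> space M. R x < d} \<le> ennreal (A * d\<^sup>2)"
  shows "(\<integral>\<^sup>+x. ennreal (R x powr (- \<gamma>)) * indicator {x \<in> space M. R x < r} x \<partial>M)
    \<le> ennreal (max 1 (2 powr \<gamma>) / (1 - 2 powr (\<gamma> - 2)) * A * r powr (2 - \<gamma>))"
proof -
  let ?m = "max 1 (2 powr \<gamma>)"
  define q where "q = 2 powr (\<gamma> - 2)"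
  have q: "0 < q" "q < 1" using \<gamma> by (auto simp: q_def powr_less_one)
  define S where "S j = {x \<in> space M. R x < r / 2 ^ j}" for j :: nat
  have [measurable]: "S j \<in> sets M" for j unfolding S_def by measurable
  \<comment> \<open>\<open>b j\<close> bounds the integrand on the shell between
    \<open>r / 2 ^ Suc j\<close> and \<open>r / 2 ^ j\<close>. In \<open>?m\<close>,
    \<open>2 powr \<gamma>\<close> is for nonnegative \<open>\<gamma>\<close>, where the inner
    radius is decisive, and 1 for negative \<open>\<gamma>\<close>.\<close>
  define b where "b j = ?m * (r / 2 ^ j) powr (- \<gamma>)" for j :: nat
  have b: "0 \<le> b j" for j by (simp add: b_def le_max_iff_disj)
  have pointwise: "ennreal (R x powr (- \<gamma>)) * indicator {x \<in> space M. R x < r} x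
      \<le> (\<Sum>j. ennreal (b j) * indicator (S j) x)" if x: "x \<in> space M" for x
  proof (cases "0 < R x \<and> R x < r")
    case False
    then have "R x = 0 \<or> \<not> R x < r" using R[of x] by linarith
    then show ?thesis by auto
  next
    case True
    obtain n where n: "r / 2 ^ n \<le> R x"
    proof -
      obtain n where "(1/2) ^ n < R x / r"
        using real_arch_pow_inv[of "R x / r" "1/2"] True r by auto
      then show ?thesis using r that[of n] by (simp add: field_simps power_one_over)
    qed
    \<comment> \<open>The least such exponent locates the dyadic shell containing
      \<open>R x\<close>; it is not 0 because \<open>R x < r\<close>.\<close>
    define k where "k = (LEAST n. r / 2 ^ n \<le> R x)"
    have k: "r / 2 ^ k \<le> R x" unfolding k_def using n by (rule LeastI)
    have "k \<noteq> 0" using k True by (intro notI) auto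
    then obtain j where j: "k = Suc j" using not0_implies_Suc by blast
    have jlt: "R x < r / 2 ^ j" using not_less_Least[of j "\<lambda>n. r / 2 ^ n \<le> R x"] j
      by (simp add: k_def)
    have "R x powr (- \<gamma>) \<le> b j"
    proof (cases "0 \<le> \<gamma>")
      case True
      have "R x powr (- \<gamma>) \<le> (r / 2 ^ k) powr (- \<gamma>)"
        using True k r by (intro powr_mono2') auto
      also have "(r / 2 ^ k) powr (- \<gamma>) = (r / 2 ^ j * (1/2)) powr (- \<gamma>)" by (simp add: j mult.commute)
      also have "\<dots> = (r / 2 ^ j) powr (- \<gamma>) * 2 powr \<gamma>"
        using r by (subst powr_mult) (auto simp: powr_minus powr_divide inverse_eq_divide)
      also have "\<dots> \<le> b j" unfolding b_def by (subst mult.commute, intro mult_right_mono) auto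
      finally show ?thesis .
    next
      case False
      then have "R x powr (- \<gamma>) \<le> 1 * (r / 2 ^ j) powr (- \<gamma>)"
        using True jlt by (simp add: powr_mono2)
      also have "\<dots> \<le> b j" unfolding b_def by (intro mult_right_mono) auto
      finally show ?thesis .
    qed
    then have "ennreal (R x powr (- \<gamma>)) * indicator {x \<in> space M. R x < r} x \<le> ennreal (b j) * indicator (S j) x"
      using x True jlt by (simp add: S_def ennreal_leI)
    also have "\<dots> \<le> (\<Sum>j. ennreal (b j) * indicator (S j) x)"
    proof -
      have "sum (\<lambda>j. ennreal (b j) * indicator (S j) x) {j} \<le> (\<Sum>j. ennreal (b j) * indicator (S j) x)"
        by (rule sum_le_suminf) auto
      then show ?thesis
        by (simp only: sum.insert finite.emptyI empty_iff not_False_eq_True sum.empty add_0_right)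
    qed
    finally show ?thesis .
  qed
  \<comment> \<open>Height times measure forms a geometric sequence of ratio
    \<open>2 powr (\<gamma> - 2)\<close>; \<open>\<gamma> < 2\<close> makes it summable.\<close>
  have level: "b j * (A * (r / 2 ^ j)\<^sup>2) = ?m * A * r powr (2 - \<gamma>) * q ^ j" for j
  proof -
    have "(r / 2 ^ j) powr (- \<gamma>) * (r / 2 ^ j)\<^sup>2 = (r / 2 ^ j) powr (2 - \<gamma>)"
      using r by (simp add: powr_diff powr_minus field_simps)
    also have "\<dots> = r powr (2 - \<gamma>) / (2 ^ j) powr (2 - \<gamma>)"
      using r by (simp add: powr_divide)
    also have "(2 ^ j) powr (2 - \<gamma>) = (2 powr (2 - \<gamma>)) ^ j"
      by (simp add: powr_powr mult.commute flip: powr_realpow)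
    also have "r powr (2 - \<gamma>) / (2 powr (2 - \<gamma>)) ^ j = r powr (2 - \<gamma>) * q ^ j"
      using powr_minus_divide[of 2 "2 - \<gamma>"] by (simp add: q_def power_one_over)
    finally show ?thesis by (simp add: b_def mult_ac)
  qed
  have "(\<integral>\<^sup>+x. ennreal (R x powr (- \<gamma>)) * indicator {x \<in> space M. R x < r} x \<partial>M)
      \<le> (\<integral>\<^sup>+x. (\<Sum>j. ennreal (b j) * indicator (S j) x) \<partial>M)"
    by (intro nn_integral_mono pointwise)
  also have "\<dots> = (\<Sum>j. \<integral>\<^sup>+x. ennreal (b j) * indicator (S j) x \<partial>M)"
    by (intro nn_integral_suminf) auto
  also have "\<dots> = (\<Sum>j. ennreal (b j) * emeasure M (S j))"
    by (simp add: nn_integral_cmult_indicator)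
  also have "\<dots> \<le> (\<Sum>j. ennreal (?m * A * r powr (2 - \<gamma>) * q ^ j))"
  proof (intro suminf_le summableI)
    fix j
    have "emeasure M (S j) \<le> ennreal (A * (r / 2 ^ j)\<^sup>2)"
      unfolding S_def using r by (intro bound) (auto simp: divide_le_eq mult_le_cancel_left1)
    then have "ennreal (b j) * emeasure M (S j) \<le> ennreal (b j) * ennreal (A * (r / 2 ^ j)\<^sup>2)"
      by (intro mult_left_mono) auto
    also have "\<dots> = ennreal (b j * (A * (r / 2 ^ j)\<^sup>2))"
      using b A by (simp add: ennreal_mult)
    finally show "ennreal (b j) * emeasure M (S j) \<le> ennreal (?m * A * r powr (2 - \<gamma>) * q ^ j)"
      unfolding level .
  qed
  also have "\<dots> = ennreal (\<Sum>j. ?m * A * r powr (2 - \<gamma>) * q ^ j)"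
    using q A by (intro suminf_ennreal2 summable_mult summable_geometric) auto
  also have "(\<Sum>j. ?m * A * r powr (2 - \<gamma>) * q ^ j) = ?m * A * r powr (2 - \<gamma>) * (1 / (1 - q))"
    using q by (simp add: suminf_mult suminf_geometric summable_geometric)
  also have "\<dots> = ?m / (1 - 2 powr (\<gamma> - 2)) * A * r powr (2 - \<gamma>)"
    by (simp add: q_def)
  finally show ?thesis .
qed

text \<open>The two integrands differ only on \<open>{R < r}\<close>. There the original is
  controlled by the dyadic estimate and the truncated one by its height
  \<open>r powr (- \<gamma>)\<close> times the measure. An abstract finite measure lets this serve
  both the cell and the time interval.\<close>

lemma truncation_error:
  fixes R :: "'a \<Rightarrow> real"
  assumes fin: "finite_measure M"
    and R_meas [measurable]: "R \<in> borel_measurable M" and R: "\<And>x. 0 \<le> R x"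
    and \<gamma>: "0 < \<gamma>" "\<gamma> < 2" and r: "0 < r" and A: "0 \<le> A"
    and bound: "\<And>d. \<lbrakk>0 < d; d \<le> r\<rbrakk> \<Longrightarrow> emeasure M {x \<in> space M. R x < d} \<le> ennreal (A * d\<^sup>2)"
  shows "integrable M (\<lambda>x. R x powr (- \<gamma>))"
    and "\<bar>(\<integral>x. R x powr (- \<gamma>) \<partial>M) - (\<integral>x. max (R x) r powr (- \<gamma>) \<partial>M)\<bar>
      \<le> (2 powr \<gamma> / (1 - 2 powr (\<gamma> - 2)) + 1) * A * r powr (2 - \<gamma>)"
proof -
  interpret finite_measure M by (rule fin)
  let ?K = "2 powr \<gamma> / (1 - 2 powr (\<gamma> - 2))"
  have "1 \<le> 2 powr \<gamma>" using \<gamma> by (intro ge_one_powr_ge_zero) auto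
  then have m: "max 1 (2 powr \<gamma>) = 2 powr \<gamma>" by simp
  have K: "0 < ?K" using \<gamma> by (simp add: powr_less_one)
  define S where "S = {x \<in> space M. R x < r}"
  have S [measurable]: "S \<in> sets M" unfolding S_def by measurable
  define h where "h x = R x powr (- \<gamma>) * indicator S x" for x
  have [measurable]: "h \<in> borel_measurable M" unfolding h_def by measurable
  have h0: "0 \<le> h x" for x by (simp add: h_def)
  have "(\<integral>\<^sup>+x. ennreal (h x) \<partial>M) = (\<integral>\<^sup>+x. ennreal (R x powr (- \<gamma>)) * indicator S x \<partial>M)"
    by (intro nn_integral_cong) (simp add: h_def indicator_def)
  also have "\<dots> \<le> ennreal (?K * A * r powr (2 - \<gamma>))"
    using nn_integral_neg_powr[OF R_meas R \<gamma>(2) r A bound] unfolding S_def m by simp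
  finally have h_nn: "(\<integral>\<^sup>+x. ennreal (h x) \<partial>M) \<le> ennreal (?K * A * r powr (2 - \<gamma>))" .
  have h_int: "integrable M h"
    using h_nn h0 by (intro integrableI_nonneg) (auto simp: top.not_eq_extremum[symmetric] top_unique)
  have h_le: "integral\<^sup>L M h \<le> ?K * A * r powr (2 - \<gamma>)"
    using K A by (intro integral_real_bounded h_nn mult_nonneg_nonneg) auto
  have c_int: "integrable M (\<lambda>x. r powr (- \<gamma>) * indicator S x)"
    by (intro integrable_mult_right integrable_real_indicator S) (simp add: less_top[symmetric])
  have g_int: "integrable M (\<lambda>x. max (R x) r powr (- \<gamma>))"
  proof (rule integrable_const_bound)
    show "AE x in M. norm (max (R x) r powr (- \<gamma>)) \<le> r powr (- \<gamma>)"
      using r \<gamma> by (auto intro!: powr_mono2')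
  qed measurable
  show f_int: "integrable M (\<lambda>x. R x powr (- \<gamma>))"
  proof (rule Bochner_Integration.integrable_bound[OF Bochner_Integration.integrable_add[OF h_int g_int]])
    show "AE x in M. norm (R x powr (- \<gamma>)) \<le> norm (h x + max (R x) r powr (- \<gamma>))"
    proof (rule AE_I2)
      fix x assume "x \<in> space M"
      then show "norm (R x powr (- \<gamma>)) \<le> norm (h x + max (R x) r powr (- \<gamma>))"
        by (cases "R x < r") (auto simp: h_def S_def max_def)
    qed
  qed measurable
  have "measure M S \<le> A * r\<^sup>2"
  proof -
    have "emeasure M S \<le> ennreal (A * r\<^sup>2)" unfolding S_def using r by (intro bound) auto
    then show ?thesis using A by (simp add: emeasure_eq_measure)
  qed
  then have "r powr (- \<gamma>) * measure M S \<le> r powr (- \<gamma>) * (A * r\<^sup>2)" by (intro mult_left_mono) auto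
  also have "\<dots> = A * r powr (2 - \<gamma>)"
    using r by (simp add: powr_diff powr_minus field_simps)
  finally have c_le: "(\<integral>x. r powr (- \<gamma>) * indicator S x \<partial>M) \<le> A * r powr (2 - \<gamma>)"
    using S sets.sets_into_space[OF S] by (simp add: Int_absorb2)
  have "\<bar>(\<integral>x. R x powr (- \<gamma>) \<partial>M) - (\<integral>x. max (R x) r powr (- \<gamma>) \<partial>M)\<bar>
      = \<bar>\<integral>x. R x powr (- \<gamma>) - max (R x) r powr (- \<gamma>) \<partial>M\<bar>"
    by (simp add: Bochner_Integration.integral_diff f_int g_int)
  also have "\<dots> \<le> (\<integral>x. \<bar>R x powr (- \<gamma>) - max (R x) r powr (- \<gamma>)\<bar> \<partial>M)"
    by (rule integral_abs_bound)
  also have "\<dots> \<le> (\<integral>x. h x + r powr (- \<gamma>) * indicator S x \<partial>M)"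
  proof (rule integral_mono)
    fix x assume x: "x \<in> space M"
    show "\<bar>R x powr (- \<gamma>) - max (R x) r powr (- \<gamma>)\<bar> \<le> h x + r powr (- \<gamma>) * indicator S x"
    proof (cases "R x < r")
      case True
      have "\<bar>a - b\<bar> \<le> a + b" if "0 \<le> a" "0 \<le> b" for a b :: real using that by linarith
      then show ?thesis using True x by (simp add: h_def S_def max_def)
    next
      case False
      then show ?thesis by (simp add: h_def S_def max_def)
    qed
  qed (use f_int g_int h_int c_int in auto)
  also have "\<dots> = integral\<^sup>L M h + (\<integral>x. r powr (- \<gamma>) * indicator S x \<partial>M)"
    by (rule Bochner_Integration.integral_add[OF h_int c_int])
  also have "\<dots> \<le> ?K * A * r powr (2 - \<gamma>) + A * r powr (2 - \<gamma>)"
    by (intro add_mono h_le c_le)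
  finally show "\<bar>(\<integral>x. R x powr (- \<gamma>) \<partial>M) - (\<integral>x. max (R x) r powr (- \<gamma>) \<partial>M)\<bar>
      \<le> (?K + 1) * A * r powr (2 - \<gamma>)"
    by (simp add: algebra_simps)
qed

section \<open>Lebesgue measure on the plane in product coordinates\<close>

definition plane_of :: "real \<times> real \<Rightarrow> real^2" where
  "plane_of z = fst z *\<^sub>R axis 1 1 + snd z *\<^sub>R axis 2 1"

lemma plane_of_nth [simp]: "plane_of z $ 1 = fst z" "plane_of z $ 2 = snd z"
  by (simp_all add: plane_of_def axis_def)

lemma plane_of_measurable [measurable]: "plane_of \<in> borel_measurable borel"
  unfolding plane_of_def by (intro borel_measurable_continuous_onI continuous_intros)

text \<open>Lebesgue measure is determined by its values on boxes, and the preimage of a box is the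
  box with the same sides.\<close>

lemma lborel_plane: "(lborel :: (real^2) measure) = distr lborel borel plane_of"
proof (rule lborel_eqI)
  fix l u :: "real^2"
  assume lu: "\<And>b. b \<in> Basis \<Longrightarrow> l \<bullet> b \<le> u \<bullet> b"
  have le: "l $ 1 \<le> u $ 1" "l $ 2 \<le> u $ 2"
    using lu[of "axis 1 1"] lu[of "axis 2 1"] by (auto simp: Basis_vec_def inner_axis)
  have "plane_of -` box l u = box (l $ 1, l $ 2) (u $ 1, u $ 2)"
    by (auto simp: mem_box_cart forall_2 mem_box Basis_prod_def)
  then have "emeasure (distr lborel borel plane_of) (box l u) = 
      emeasure lborel (box (l $ 1, l $ 2) (u $ 1, u $ 2))"
    by (simp add: emeasure_distr)
  also have "\<dots> = ennreal ((u $ 1 - l $ 1) * (u $ 2 - l $ 2))"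
    using le by (subst emeasure_lborel_box) (auto simp: Basis_prod_def prod.union_disjoint image_iff)
  also have "(u $ 1 - l $ 1) * (u $ 2 - l $ 2) = (\<Prod>b\<in>Basis. (u - l) \<bullet> b)"
  proof -
    have B: "(Basis :: (real^2) set) = {axis 1 1, axis 2 1}"
      by (auto simp: Basis_vec_def UNIV_2)
    have "axis 1 1 \<noteq> (axis 2 1 :: real^2)" by (simp add: axis_eq_axis)
    then show ?thesis unfolding B by (simp add: inner_axis)
  qed
  finally show "emeasure (distr lborel borel plane_of) (box l u) = (\<Prod>b\<in>Basis. (u - l) \<bullet> b)" .
qed simp

lemma torus_cell_cbox: "torus_cell = cbox 0 1"
  by (auto simp: torus_cell_def mem_box_cart)

lemma torus_cell_sets [measurable]: "torus_cell \<in> sets borel"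
  by (simp add: torus_cell_cbox)

context lipschitz_torus
begin

text \<open>The cell is pulled back to the unit square of pairs, where the integral of a continuous
  function can be iterated.\<close>

lemma torus_integral_eq_mean: "(LBINT x:torus_cell. g (x $ 1) (x $ 2)) = mean"
proof -
  let ?F = "\<lambda>z. g (fst z) (snd z)"
  let ?I = "cbox (0, 0) (1, 1) :: (real \<times> real) set"
  have [measurable]: "?F \<in> borel_measurable borel" 
    by (intro borel_measurable_continuous_onI continuous_intros)
  have [measurable]: "(\<lambda>x :: real^2. g (x $ 1) (x $ 2)) \<in> borel_measurable borel"
    by (intro borel_measurable_continuous_onI continuous_intros)
  have ind: "indicator torus_cell (plane_of z) = (indicator ?I z :: real)" for z
    by (cases z) (auto simp: indicator_def torus_cell_def forall_2 cbox_Pair_eq)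
  have "(LBINT x:torus_cell. g (x $ 1) (x $ 2)) =
      (\<integral>z. indicator torus_cell (plane_of z) *\<^sub>R g (plane_of z $ 1) (plane_of z $ 2) \<partial>lborel)"
    unfolding set_lebesgue_integral_def
    by (subst lborel_plane, subst integral_distr) simp_all
  also have "\<dots> = (LBINT z:?I. ?F z)"
    unfolding set_lebesgue_integral_def by (simp add: ind)
  also have "\<dots> = integral ?I ?F"
    by (intro set_borel_integral_eq_integral)
      (unfold set_integrable_def, intro borel_integrable_compact compact_cbox continuous_intros)
  also have "\<dots> = mean"
    unfolding mean_def by (subst integral_prod_continuous) (auto intro!: continuous_intros)
  finally show ?thesis .
qed

end

section \<open>Truncation errors on the torus and along the line\<close>

lemma rho_cut_lipschitz_torus:
  "0 < r \<Longrightarrow> 0 < \<gamma> \<Longrightarrow> lipschitz_torus (rho_cut \<gamma> r) (6 * \<gamma> * r powr (- \<gamma> - 1))"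
  by unfold_locales (auto intro: rho_cut_lipschitz rho_cut_periodic)

lemma rho_plane_measurable: "(\<lambda>x :: real^2. rho (x $ 1) (x $ 2)) \<in> borel_measurable borel"
  by (intro borel_measurable_continuous_onI continuous_intros)

lemma rho_line_measurable: "(\<lambda>x. rho (x * v) (x * w)) \<in> borel_measurable borel"
  by (intro borel_measurable_continuous_onI continuous_intros)

lemma torus_truncation:
  assumes \<gamma>: "0 < \<gamma>" "\<gamma> < 2" and r: "0 < r" "r \<le> 1"
  shows "torus_integrable (inv_sqrt_U \<gamma>)"
    and "\<bar>torus_integral (inv_sqrt_U \<gamma>) - lipschitz_torus.mean (rho_cut \<gamma> r)\<bar>
      \<le> (2 powr \<gamma> / (1 - 2 powr (\<gamma> - 2)) + 1) * 36 * r powr (2 - \<gamma>)"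
proof -
  interpret lipschitz_torus "rho_cut \<gamma> r" "6 * \<gamma> * r powr (- \<gamma> - 1)"
    using rho_cut_lipschitz_torus \<gamma> r by blast
  let ?M = "restrict_space lborel torus_cell"
  have fin: "finite_measure ?M"
    by (rule finite_measureI) (simp add: emeasure_restrict_space space_restrict_space torus_cell_cbox emeasure_lborel_cbox_eq)
  have meas: "(\<lambda>x. rho (x $ 1) (x $ 2)) \<in> borel_measurable ?M"
    by (rule measurable_restrict_space1) (simp add: rho_plane_measurable)
  have hits: "emeasure ?M {x \<in> space ?M. rho (x $ 1) (x $ 2) < d} \<le> ennreal (36 * d\<^sup>2)"
    if "0 < d" "d \<le> r" for d
  proof -
    have "emeasure ?M {x \<in> space ?M. rho (x $ 1) (x $ 2) < d} = 
        emeasure lborel {x \<in> torus_cell. rho (x $ 1) (x $ 2) < d}"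
      by (subst emeasure_restrict_space) (auto simp: space_restrict_space)
    then show ?thesis using cell_hits[of d] that r by simp
  qed
  have tr: "integrable ?M (\<lambda>x. rho (x $ 1) (x $ 2) powr (- \<gamma>))"
    "\<bar>(\<integral>x. rho (x $ 1) (x $ 2) powr (- \<gamma>) \<partial>?M) - (\<integral>x. max (rho (x $ 1) (x $ 2)) r powr (- \<gamma>) \<partial>?M)\<bar>
      \<le> (2 powr \<gamma> / (1 - 2 powr (\<gamma> - 2)) + 1) * 36 * r powr (2 - \<gamma>)"
    by (rule truncation_error[OF fin meas rho_nonneg \<gamma> r(1) _ hits]; simp)+
  show "torus_integrable (inv_sqrt_U \<gamma>)"
    using tr(1) unfolding torus_integrable_def set_integrable_def inv_sqrt_U_eq
    by (subst (asm) integrable_restrict_space) auto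
  have "torus_integral (inv_sqrt_U \<gamma>) = (\<integral>x. rho (x $ 1) (x $ 2) powr (- \<gamma>) \<partial>?M)"
    unfolding torus_integral_def set_lebesgue_integral_def inv_sqrt_U_eq
    by (subst integral_restrict_space) auto
  moreover have "mean = (\<integral>x. max (rho (x $ 1) (x $ 2)) r powr (- \<gamma>) \<partial>?M)"
    unfolding torus_integral_eq_mean[symmetric] set_lebesgue_integral_def rho_cut_def
    by (subst integral_restrict_space) auto
  ultimately show "\<bar>torus_integral (inv_sqrt_U \<gamma>) - mean\<bar>
      \<le> (2 powr \<gamma> / (1 - 2 powr (\<gamma> - 2)) + 1) * 36 * r powr (2 - \<gamma>)"
    using tr(2) by simp
qed

lemma line_continuous:
  assumes "dioph v w \<sigma> c"
  shows "continuous_on S (\<lambda>x. rho (x * v) (x * w) powr (- \<gamma>))"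
  using rho_line_pos[OF assms] by (intro continuous_intros) (auto simp: less_le)

lemma line_integrable_inv_sqrt_U:
  assumes "diophantine_index \<xi> \<sigma>"
  shows "line_integrable (inv_sqrt_U \<gamma>) \<xi> T"
proof -
  obtain c where "dioph (\<xi> $ 1) (\<xi> $ 2) \<sigma> c" using dioph_exists[OF assms] .
  from line_continuous[OF this, of "{0..T}" \<gamma>] show ?thesis
    unfolding line_integrable_def inv_sqrt_U_eq by (intro borel_integrable_atLeastAtMost') simp
qed

lemma line_average_eq:
  assumes "diophantine_index \<xi> \<sigma>"
  shows "line_average (inv_sqrt_U \<gamma>) \<xi> T =
    1 / T * integral {0..T} (\<lambda>x. rho (x * \<xi> $ 1) (x * \<xi> $ 2) powr (- \<gamma>))"
  using set_borel_integral_eq_integral(2)[OF line_integrable_inv_sqrt_U[OF assms, unfolded line_integrable_def], of T \<gamma>]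
  unfolding line_average_def by (simp add: inv_sqrt_U_eq)

text \<open>The measure bound on \<open>{0..T}\<close> has constant \<open>A * T\<close>; dividing
  by the length \<open>T\<close> leaves a truncation error uniform in \<open>T\<close>.\<close>

lemma line_truncation:
  assumes D: "diophantine_index \<xi> 1" and \<gamma>: "0 < \<gamma>" "\<gamma> < 2"
  obtains A where "0 < A" "\<And>T r. \<lbrakk>1 \<le> T; 0 < r; r \<le> 1\<rbrakk> \<Longrightarrow>
    \<bar>line_average (inv_sqrt_U \<gamma>) \<xi> T - 1 / T * integral {0..T} (\<lambda>x. rho_cut \<gamma> r (x * \<xi> $ 1) (x * \<xi> $ 2))\<bar>
      \<le> (2 powr \<gamma> / (1 - 2 powr (\<gamma> - 2)) + 1) * A * r powr (2 - \<gamma>)"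
proof -
  let ?v = "\<xi> $ 1" and ?w = "\<xi> $ 2" and ?K = "2 powr \<gamma> / (1 - 2 powr (\<gamma> - 2)) + 1"
  obtain c where c: "dioph ?v ?w 1 c" using dioph_exists[OF D] .
  obtain A where A: "0 < A" and hits: "\<And>T d. \<lbrakk>1 \<le> T; 0 < d; d \<le> 1\<rbrakk> \<Longrightarrow>
       emeasure lborel {x \<in> {0..T}. rho (x * ?v) (x * ?w) < d} \<le> ennreal (A * T * d\<^sup>2)"
    using line_hits[OF c] by blast
  show ?thesis
  proof (rule that[OF A])
    fix T r :: real assume T: "1 \<le> T" and r: "0 < r" "r \<le> 1"
    interpret lipschitz_torus "rho_cut \<gamma> r" "6 * \<gamma> * r powr (- \<gamma> - 1)"
      using rho_cut_lipschitz_torus \<gamma> r by blast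
    let ?M = "restrict_space lborel {0..T}"
    let ?R = "\<lambda>x. rho (x * ?v) (x * ?w)"
    have fin: "finite_measure ?M"
      by (rule finite_measureI) (use T in \<open>simp add: emeasure_restrict_space space_restrict_space\<close>)
    have meas: "?R \<in> borel_measurable ?M"
      by (rule measurable_restrict_space1) (simp add: rho_line_measurable)
    have hits': "emeasure ?M {x \<in> space ?M. ?R x < d} \<le> ennreal (A * T * d\<^sup>2)"
      if "0 < d" "d \<le> r" for d
    proof -
      have "emeasure ?M {x \<in> space ?M. ?R x < d} = emeasure lborel {x \<in> {0..T}. ?R x < d}"
        by (subst emeasure_restrict_space) (auto simp: space_restrict_space)
      then show ?thesis using hits[of T d] that r T by simp
    qed
    have AT: "0 \<le> A * T" using A T by simp
    have eq: "(\<integral>x. F x \<partial>?M) = integral {0..T} F" if "continuous_on {0..T} F" for F :: "real \<Rightarrow> real"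
    proof -
      have "(\<integral>x. F x \<partial>?M) = (LBINT x:{0..T}. F x)"
        unfolding set_lebesgue_integral_def by (subst integral_restrict_space) auto
      then show ?thesis
        using set_borel_integral_eq_integral(2)[OF borel_integrable_atLeastAtMost'[OF that]] by simp
    qed
    have "\<bar>(\<integral>x. ?R x powr (- \<gamma>) \<partial>?M) - (\<integral>x. max (?R x) r powr (- \<gamma>) \<partial>?M)\<bar>
        \<le> ?K * (A * T) * r powr (2 - \<gamma>)"
      by (rule truncation_error(2)[OF fin meas rho_nonneg \<gamma> r(1) AT hits'])
    moreover have "(\<integral>x. ?R x powr (- \<gamma>) \<partial>?M) = T * line_average (inv_sqrt_U \<gamma>) \<xi> T"
      using T unfolding line_average_eq[OF D] by (subst eq) (auto intro: line_continuous[OF c])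
    moreover have "(\<integral>x. max (?R x) r powr (- \<gamma>) \<partial>?M) = integral {0..T} (\<lambda>x. rho_cut \<gamma> r (x * ?v) (x * ?w))"
      unfolding rho_cut_def[symmetric] by (rule eq) (intro continuous_intros)
    ultimately have "\<bar>T * line_average (inv_sqrt_U \<gamma>) \<xi> T - integral {0..T} (\<lambda>x. rho_cut \<gamma> r (x * ?v) (x * ?w))\<bar>
        \<le> T * (?K * A * r powr (2 - \<gamma>))" by (simp add: mult_ac)
    moreover have "\<bar>a - 1 / T * b\<bar> \<le> e" if "\<bar>T * a - b\<bar> \<le> T * e" for a b e
    proof -
      have "T * \<bar>a - 1 / T * b\<bar> = \<bar>T * a - b\<bar>"
        using T abs_mult[of T "a - 1 / T * b"] by (simp add: right_diff_distrib)
      then have "T * \<bar>a - 1 / T * b\<bar> \<le> T * e" using that by simp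
      then show ?thesis using T by simp
    qed
    ultimately show "\<bar>line_average (inv_sqrt_U \<gamma>) \<xi> T - 1 / T * integral {0..T} (\<lambda>x. rho_cut \<gamma> r (x * ?v) (x * ?w))\<bar>
        \<le> ?K * A * r powr (2 - \<gamma>)" by blast
  qed
qed

text \<open>Three errors are added: truncation along the line, equidistribution of the truncated
  function, and truncation on the torus.\<close>

lemma line_average_convergence:
  assumes D: "diophantine_index \<xi> 1" and \<gamma>: "0 < \<gamma>" "\<gamma> < 2"
  obtains C where "0 < C" "\<And>T. 1 \<le> T \<Longrightarrow>
    \<bar>line_average (inv_sqrt_U \<gamma>) \<xi> T - torus_integral (inv_sqrt_U \<gamma>)\<bar> \<le> C * T powr (- ((2 - \<gamma>) / 6))"
proof -
  let ?v = "\<xi> $ 1" and ?w = "\<xi> $ 2"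
  define K where "K = 2 powr \<gamma> / (1 - 2 powr (\<gamma> - 2)) + 1"
  have K: "0 < K" using \<gamma> by (auto simp: K_def powr_less_one intro!: add_pos_pos)
  obtain c where c: "dioph ?v ?w 1 c" using dioph_exists[OF D] .
  obtain B where B: "0 < B" and equi: "\<And>g L M T. \<lbrakk>lipschitz_torus g L; \<And>a b. \<bar>g a b\<bar> \<le> M; 1 \<le> T\<rbrakk> \<Longrightarrow>
       \<bar>1 / T * integral {0..T} (\<lambda>x. g (x * ?v) (x * ?w)) - lipschitz_torus.mean g\<bar> \<le> B * (L + M) / sqrt T"
    using equidistribution[OF c] by blast
  obtain A where A: "0 < A" and line: "\<And>T r. \<lbrakk>1 \<le> T; 0 < r; r \<le> 1\<rbrakk> \<Longrightarrow>
    \<bar>line_average (inv_sqrt_U \<gamma>) \<xi> T - 1 / T * integral {0..T} (\<lambda>x. rho_cut \<gamma> r (x * ?v) (x * ?w))\<bar>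
      \<le> K * A * r powr (2 - \<gamma>)"
    using line_truncation[OF D \<gamma>] unfolding K_def by blast
  define C where "C = K * A + K * 36 + B * (6 * \<gamma> + 1)"
  have C: "0 < C" using K A B \<gamma> by (auto simp: C_def intro!: add_pos_pos mult_pos_pos)
  show ?thesis
  proof (rule that[OF C])
    fix T :: real assume T: "1 \<le> T"
    \<comment> \<open>This choice balances the errors: \<open>sqrt T = r powr (- 3)\<close>, so the
      equidistribution error \<open>r powr (- \<gamma> - 1) / sqrt T\<close> equals the truncation
      error \<open>r powr (2 - \<gamma>)\<close>.\<close>
    define r where "r = T powr (- 1 / 6)"
    have r: "0 < r" "r \<le> 1"
      using T powr_mono[of "- 1 / 6" 0 T] by (auto simp: r_def)
    have e: "\<bar>1 / T * integral {0..T} (\<lambda>x. rho_cut \<gamma> r (x * ?v) (x * ?w)) - lipschitz_torus.mean (rho_cut \<gamma> r)\<bar>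
        \<le> B * (6 * \<gamma> * r powr (- \<gamma> - 1) + r powr (- \<gamma>)) / sqrt T"
      using \<gamma> r T by (intro equi rho_cut_lipschitz_torus) (auto simp: abs_of_nonneg rho_cut_nonneg rho_cut_le)
    have "r powr (- \<gamma>) \<le> r powr (- \<gamma> - 1)"
      using r by (intro powr_mono') auto
    then have "6 * \<gamma> * r powr (- \<gamma> - 1) + r powr (- \<gamma>) \<le> (6 * \<gamma> + 1) * r powr (- \<gamma> - 1)"
      by (simp add: algebra_simps)
    then have "B * (6 * \<gamma> * r powr (- \<gamma> - 1) + r powr (- \<gamma>)) / sqrt T \<le> B * ((6 * \<gamma> + 1) * r powr (- \<gamma> - 1)) / sqrt T"
      using B T by (intro divide_right_mono mult_left_mono) auto
    also have "\<dots> = B * (6 * \<gamma> + 1) * (r powr (- \<gamma> - 1) / sqrt T)" by simp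
    also have "r powr (- \<gamma> - 1) / sqrt T = r powr (2 - \<gamma>)"
    proof -
      have "sqrt T = r powr (- 3)"
        using T by (simp add: r_def powr_powr powr_half_sqrt)
      then have "r powr (- \<gamma> - 1) / sqrt T = r powr ((- \<gamma> - 1) - (- 3))" by (simp only: powr_diff)
      then show ?thesis by simp
    qed
    finally have e': "B * (6 * \<gamma> * r powr (- \<gamma> - 1) + r powr (- \<gamma>)) / sqrt T \<le> B * (6 * \<gamma> + 1) * r powr (2 - \<gamma>)" .
    have "\<bar>line_average (inv_sqrt_U \<gamma>) \<xi> T - torus_integral (inv_sqrt_U \<gamma>)\<bar>
        \<le> K * A * r powr (2 - \<gamma>) + K * 36 * r powr (2 - \<gamma>) + B * (6 * \<gamma> + 1) * r powr (2 - \<gamma>)"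
      using line[OF T r] torus_truncation(2)[OF \<gamma> r, folded K_def] e e' by linarith
    also have "\<dots> = C * r powr (2 - \<gamma>)" by (simp add: C_def algebra_simps)
    also have "r powr (2 - \<gamma>) = T powr (- ((2 - \<gamma>) / 6))"
      by (simp add: r_def powr_powr)
    finally show "\<bar>line_average (inv_sqrt_U \<gamma>) \<xi> T - torus_integral (inv_sqrt_U \<gamma>)\<bar> \<le> C * T powr (- ((2 - \<gamma>) / 6))" .
  qed
qed

subsection \<open>Lower bounds\<close>

text \<open>On the triangle where \<open>b\<close> lies between \<open>1/4\<close> and
  \<open>a\<close>, \<open>rho\<close> is at most \<open>12 * (a - 1/4)\<close>. Integrating the
  inverse square over \<open>b\<close> leaves a multiple of \<open>1 / (a - 1/4)\<close>, whose
  integral is the logarithm.\<close>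

lemma rho_cut_mean_lower:
  assumes r: "0 < r" "r \<le> 3/4"
  shows "(ln (3/4) - ln r) / 144 \<le> lipschitz_torus.mean (rho_cut 2 r)"
proof -
  interpret lipschitz_torus "rho_cut 2 r" "6 * 2 * r powr (- 2 - 1)"
    using rho_cut_lipschitz_torus[of r 2] r by simp
  let ?G = "\<lambda>a. integral {0..1} (rho_cut 2 r a)"
  have int: "rho_cut 2 r a integrable_on {c..d}" for a c d
    by (intro integrable_continuous_real continuous_intros)
  have G_int: "?G integrable_on {c..d}" for c d
    using integral_continuous_on_param[of "{c..d}" 0 1 "rho_cut 2 r"]
    by (intro integrable_continuous_real) (simp add: case_prod_beta continuous_intros)
  have G0: "0 \<le> ?G a" for a
    by (intro integral_nonneg int rho_cut_nonneg)
  have G_ge: "1 / (144 * (a - 1/4)) \<le> ?G a" if a: "1/4 + r \<le> a" "a \<le> 1" for a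
  proof -
    have pos: "0 < a - 1/4" using a r by linarith
    have "1 / (144 * (a - 1/4)) = integral {1/4..a} (\<lambda>b. (12 * (a - 1/4)) powr (- 2))"
    proof -
      have "1 / (144 * t) = t * (12 * t) powr (- 2)" if "0 < t" for t :: real
        using that by (simp add: powr_minus_divide power2_eq_square)
      from this[OF pos] show ?thesis using pos by simp
    qed
    also have "\<dots> \<le> integral {1/4..a} (rho_cut 2 r a)"
    proof (intro integral_le int)
      fix b assume b: "b \<in> {1/4..a}"
      have "rho a b \<le> 6 * (\<bar>a - 1/4\<bar> + \<bar>b - 1/4\<bar>)"
        using rho_upper[of 0 "a - 1/4" 0 "b - 1/4"] by simp
      also have "\<dots> \<le> 12 * (a - 1/4)" using b pos by simp
      finally show "(12 * (a - 1/4)) powr (- 2) \<le> rho_cut 2 r a b"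
        unfolding rho_cut_def using a r by (intro powr_mono2') auto
    qed (rule integrable_const_ivl)
    also have "\<dots> \<le> ?G a"
      using a by (intro integral_subset_le int) (auto simp: rho_cut_nonneg)
    finally show ?thesis .
  qed
  have "((\<lambda>a. 1 / (144 * (a - 1/4))) has_integral ln (1 - 1/4) / 144 - ln (1/4 + r - 1/4) / 144) {1/4 + r..1}"
    using r by (intro fundamental_theorem_of_calculus)
      (auto intro!: derivative_eq_intros simp: has_real_derivative_iff_has_vector_derivative[symmetric] field_simps)
  then have "(ln (3/4) - ln r) / 144 = integral {1/4 + r..1} (\<lambda>a. 1 / (144 * (a - 1/4)))"
    and *: "(\<lambda>a. 1 / (144 * (a - 1/4))) integrable_on {1/4 + r..1}"
    by (auto simp: has_integral_iff diff_divide_distrib)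
  note this(1)
  also have "integral {1/4 + r..1} (\<lambda>a. 1 / (144 * (a - 1/4))) \<le> integral {1/4 + r..1} ?G"
    by (intro integral_le * G_int G_ge) auto
  also have "\<dots> \<le> mean" unfolding mean_def
    using r by (intro integral_subset_le G_int) (auto intro: G0)
  finally show ?thesis .
qed

text \<open>Truncation only lowers the average. At level \<open>T powr (- 1 / 6)\<close> the
  equidistribution error stays bounded, while the mean grows like \<open>ln T / 864\<close>.\<close>

lemma line_average_log:
  assumes D: "diophantine_index \<xi> 1"
  shows "\<forall>\<^sub>F T in at_top. line_average (inv_sqrt_U 2) \<xi> T \<ge> 1 / 1728 * \<bar>ln T\<bar>"
proof -
  let ?v = "\<xi> $ 1" and ?w = "\<xi> $ 2"
  obtain c where c: "dioph ?v ?w 1 c" using dioph_exists[OF D] .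
  obtain B where B: "0 < B" and equi: "\<And>g L M T. \<lbrakk>lipschitz_torus g L; \<And>a b. \<bar>g a b\<bar> \<le> M; 1 \<le> T\<rbrakk> \<Longrightarrow>
       \<bar>1 / T * integral {0..T} (\<lambda>x. g (x * ?v) (x * ?w)) - lipschitz_torus.mean g\<bar> \<le> B * (L + M) / sqrt T"
    using equidistribution[OF c] by blast
  have "filterlim (\<lambda>T. ln T) at_top (at_top :: real filter)" by (rule ln_at_top)
  \<comment> \<open>Half of \<open>ln T / 864\<close> is kept for the conclusion; from this
    threshold on the other half outweighs the bounded terms. \<open>64 \<le> T\<close> below makes
    the level at most \<open>1/2\<close>.\<close>
  then have "\<forall>\<^sub>F T in at_top. 1728 * (13 * B - ln (3/4) / 144) \<le> ln (T :: real)"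
    by (simp add: filterlim_at_top)
  moreover have "\<forall>\<^sub>F T in at_top. (64 :: real) \<le> T" by (rule eventually_ge_at_top)
  ultimately show ?thesis
  proof eventually_elim
    case (elim T)
    define r where "r = T powr (- 1 / 6)"
    have r: "0 < r" "r \<le> 1/2"
    proof -
      have "T powr (- 1 / 6) \<le> 64 powr (- 1 / 6)" using elim by (intro powr_mono2') auto
      also have "(64 :: real) = 2 powr 6" by simp
      also have "(2 powr 6) powr (- 1 / 6) = (1/2 :: real)" by (simp only: powr_powr) (simp add: powr_minus_divide)
      finally show "r \<le> 1/2" by (simp add: r_def)
      show "0 < r" using elim by (simp add: r_def)
    qed
    interpret lipschitz_torus "rho_cut 2 r" "6 * 2 * r powr (- 2 - 1)"
      using rho_cut_lipschitz_torus[of r 2] r by simp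
    have "\<bar>1 / T * integral {0..T} (\<lambda>x. rho_cut 2 r (x * ?v) (x * ?w)) - mean\<bar>
        \<le> B * (6 * 2 * r powr (- 2 - 1) + r powr (- 2)) / sqrt T"
      using r elim by (intro equi lipschitz_torus_axioms) (auto simp: abs_of_nonneg rho_cut_nonneg rho_cut_le)
    also have "\<dots> \<le> B * (13 * r powr (- 3)) / sqrt T"
    proof (intro divide_right_mono mult_left_mono)
      have "r powr (- 2) \<le> r powr (- 3)" using r by (intro powr_mono') auto
      then show "6 * 2 * r powr (- 2 - 1) + r powr (- 2) \<le> 13 * r powr (- 3)" by simp
    qed (use B elim in auto)
    also have "sqrt T = r powr (- 3)"
      using elim by (simp add: r_def powr_powr powr_half_sqrt)
    finally have "\<bar>1 / T * integral {0..T} (\<lambda>x. rho_cut 2 r (x * ?v) (x * ?w)) - mean\<bar> \<le> 13 * B"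
      using r by (simp add: mult.commute)
    moreover have "(ln (3/4) + ln T / 6) / 144 \<le> mean"
      using rho_cut_mean_lower[of r] r elim by (simp add: r_def ln_powr)
    moreover have "1 / T * integral {0..T} (\<lambda>x. rho_cut 2 r (x * ?v) (x * ?w)) \<le> line_average (inv_sqrt_U 2) \<xi> T"
      unfolding line_average_eq[OF D]
    proof (intro mult_left_mono integral_le integrable_continuous_real line_continuous[OF c])
      fix x show "rho_cut 2 r (x * ?v) (x * ?w) \<le> rho (x * ?v) (x * ?w) powr (- 2)"
        unfolding rho_cut_def using rho_line_pos[OF c] by (intro powr_mono2') auto
    qed (use elim in \<open>auto intro!: continuous_intros\<close>)
    ultimately have "(ln (3/4) + ln T / 6) / 144 - 13 * B \<le> line_average (inv_sqrt_U 2) \<xi> T"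
      by linarith
    moreover have "(ln (3/4) + ln T / 6) / 144 = ln (3/4) / 144 + ln T / 864" by (simp add: field_simps)
    moreover have "0 \<le> ln T" using elim by simp
    ultimately show ?case using elim(1) by (simp add: algebra_simps)
  qed
qed

text \<open>The parameters at which the first coordinate is \<open>1/4\<close> modulo 1 are spaced
  by \<open>1 / q\<close>. By Bezout their second coordinates, modulo 1, run through all translates
  by multiples of \<open>1 / q\<close>, so one is within \<open>1 / \<bar>q\<bar>\<close> of the
  target.\<close>

lemma closed_line_hits:
  fixes p q :: int and z1 z2 :: real
  assumes "q \<noteq> 0" "coprime p q"
  obtains s :: real and i j :: int where "0 \<le> s" "s < 1" "z1 + of_int q * s = 1/4 + of_int i"
    "\<bar>z2 + of_int p * s - (1/4 + of_int j)\<bar> \<le> 1 / \<bar>of_int q\<bar>"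
proof -
  obtain u v where uv: "u * p + v * q = 1" using bezout_int[of p q] assms by auto
  \<comment> \<open>\<open>y\<close> is the second coordinate at one crossing of \<open>1/4\<close>,
    and \<open>t\<close> counts the steps \<open>1 / q\<close> from there towards
    \<open>1/4\<close>. The parameter \<open>s\<close> realises them and is finally reduced modulo
    1.\<close>
  define y where "y = z2 + of_int p * (1/4 - z1) / of_int q"
  define t where "t = \<lfloor>(1/4 - y) * of_int q\<rfloor>"
  define s where "s = (1/4 + of_int (t * u) - z1) / of_int q"
  have q: "(of_int q :: real) \<noteq> 0" using assms by simp
  have z1: "z1 + of_int q * s = 1/4 + of_int (t * u)" using q by (simp add: s_def)
  have uv': "of_int u * of_int p = (1 - of_int v * of_int q :: real)"
    using arg_cong[OF uv, of real_of_int] by (simp add: algebra_simps)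
  have "z2 + of_int p * s = y + of_int t * (of_int u * of_int p) / of_int q"
    by (simp add: y_def s_def add_divide_distrib diff_divide_distrib algebra_simps)
  also have "\<dots> = y + of_int t / of_int q - of_int (t * v)"
    unfolding uv' using q by (simp add: field_simps)
  finally have "z2 + of_int p * s - (1/4 + of_int (- t * v)) = - (frac ((1/4 - y) * of_int q) / of_int q)"
    using q by (simp add: t_def frac_def field_simps)
  then have z2: "\<bar>z2 + of_int p * s - (1/4 + of_int (- t * v))\<bar> \<le> 1 / \<bar>of_int q\<bar>"
    using frac_lt_1[of "(1/4 - y) * of_int q"] by (simp add: divide_right_mono less_imp_le)
  have s: "s = frac s + of_int \<lfloor>s\<rfloor>" by (simp add: frac_def)
  show ?thesis
  proof (rule that[of "frac s" "t * u - q * \<lfloor>s\<rfloor>" "- t * v - p * \<lfloor>s\<rfloor>"])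
    have "z1 + of_int q * (frac s + of_int \<lfloor>s\<rfloor>) = 1/4 + of_int (t * u)" using z1 s by simp
    then show "z1 + of_int q * frac s = 1/4 + of_int (t * u - q * \<lfloor>s\<rfloor>)" by (simp add: algebra_simps)
    have "z2 + of_int p * s - (1/4 + of_int (- t * v)) =
        z2 + of_int p * frac s - (1/4 + of_int (- t * v - p * \<lfloor>s\<rfloor>))"
      by (subst s) (simp add: algebra_simps)
    then show "\<bar>z2 + of_int p * frac s - (1/4 + of_int (- t * v - p * \<lfloor>s\<rfloor>))\<bar> \<le> 1 / \<bar>of_int q\<bar>"
      using z2 by simp
  qed (auto simp: frac_lt_1)
qed

text \<open>Each window of length \<open>2 * P\<close> contains a stretch of length
  \<open>\<delta> / Q\<close> with \<open>rho\<close> at most \<open>B / Q\<close>, contributing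
  order \<open>Q powr (\<gamma> - 1)\<close>. Division by the window length gives
  \<open>Q powr (\<gamma> - 2)\<close>, and \<open>Q\<close> is at least of order
  \<open>T powr (1 / \<sigma>)\<close>.\<close>

lemma line_average_power:
  assumes D: "diophantine_index \<xi> \<sigma>" and \<gamma>: "2 < \<gamma>"
  obtains C where "0 < C"
    "\<forall>\<^sub>F T in at_top. line_average (inv_sqrt_U \<gamma>) \<xi> T \<ge> C * T powr ((\<gamma> - 2) / \<sigma>)"
proof -
  let ?v = "\<xi> $ 1" and ?w = "\<xi> $ 2"
  obtain c where c: "dioph ?v ?w \<sigma> c" using dioph_exists[OF D] .
  have \<sigma>: "0 < \<sigma>" using c by (simp add: dioph_def)
  have v: "?v \<noteq> 0" using dioph_nonzero c .
  obtain c' where c': "0 < c'"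
    and near: "\<And>N :: nat. 0 < N \<Longrightarrow> \<exists>p q :: int. q \<noteq> 0 \<and> coprime p q \<and> \<bar>of_int q\<bar> \<le> real N \<and>
       c' * real N powr (1 / \<sigma>) \<le> \<bar>of_int q\<bar> \<and>
       \<bar>of_int q\<bar> / \<bar>?v\<bar> * ?v = of_int q \<and> \<bar>\<bar>of_int q\<bar> / \<bar>?v\<bar> * ?w - of_int p\<bar> \<le> 1 / real N"
    using dioph_near_period[OF c] by metis
  define F where "F x = rho (x * ?v) (x * ?w) powr (- \<gamma>)" for x
  have int: "F integrable_on {a..b}" for a b
    unfolding F_def by (intro integrable_continuous_real line_continuous[OF c])
  have F0: "0 \<le> F x" for x by (simp add: F_def)
  \<comment> \<open>The bound 1 limits the motion during the stretch; the bound
    \<open>1 / \<bar>?v\<bar>\<close> keeps the stretch no longer than \<open>P\<close>.\<close>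
  define \<delta> where "\<delta> = min 1 (1 / \<bar>?v\<bar>)"
  have \<delta>: "0 < \<delta>" "\<delta> \<le> 1" "\<delta> \<le> 1 / \<bar>?v\<bar>" using v by (auto simp: \<delta>_def)
  \<comment> \<open>The 12 comes from an offset of at most \<open>2 / Q\<close> at the visit, the
    rest from moving for a time of at most \<open>1 / Q\<close>.\<close>
  define B where "B = 12 + 6 * (\<bar>?v\<bar> + \<bar>?w\<bar>)"
  have B: "0 < B" by (simp add: B_def add_pos_nonneg)
  define C where "C = \<delta> * B powr (- \<gamma>) * \<bar>?v\<bar> / 4 * (c' * (\<bar>?v\<bar> / 4) powr (1 / \<sigma>)) powr (\<gamma> - 2)"
  have C: "0 < C" using \<delta> B v c' by (simp add: C_def)
  have "line_average (inv_sqrt_U \<gamma>) \<xi> T \<ge> C * T powr ((\<gamma> - 2) / \<sigma>)" if T: "max 1 (4 / \<bar>?v\<bar>) \<le> T" for T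
  proof -
    have T1: "1 \<le> T" "4 \<le> T * \<bar>?v\<bar>" using T v by (auto simp: field_simps)
    \<comment> \<open>The factor \<open>1/2\<close> ensures \<open>2 * P \<le> T\<close>, so that at
      least one window fits.\<close>
    define N where "N = nat \<lfloor>T * \<bar>?v\<bar> / 2\<rfloor>"
    have N: "T * \<bar>?v\<bar> / 4 \<le> real N" "real N \<le> T * \<bar>?v\<bar> / 2" "0 < N"
      using T1 unfolding N_def by linarith+
    obtain p q :: int where q: "q \<noteq> 0" "coprime p q" and qN: "\<bar>of_int q\<bar> \<le> real N"
      and qc: "c' * real N powr (1 / \<sigma>) \<le> \<bar>of_int q\<bar>"
      and P: "\<bar>of_int q\<bar> / \<bar>?v\<bar> * ?v = of_int q" "\<bar>\<bar>of_int q\<bar> / \<bar>?v\<bar> * ?w - of_int p\<bar> \<le> 1 / real N"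
      using near[OF N(3)] by auto
    define Q where "Q = \<bar>of_int q :: real\<bar>"
    have Q: "1 \<le> Q" using q unfolding Q_def by linarith
    define P where "P = Q / \<bar>?v\<bar>"
    have P0: "0 < P" using Q v by (simp add: P_def)
    have Pv: "P * ?v = of_int q" and Pw: "\<bar>P * ?w - of_int p\<bar> \<le> 1 / Q"
    proof -
      have "1 / real N \<le> 1 / Q" using qN Q by (simp add: Q_def frac_le)
      then show "P * ?v = of_int q" "\<bar>P * ?w - of_int p\<bar> \<le> 1 / Q"
        using P by (auto simp: P_def Q_def)
    qed
    have hit: "\<delta> * B powr (- \<gamma>) * Q powr (\<gamma> - 1) \<le> integral {x0..x0 + 2 * P} F" for x0
    proof -
      obtain s i j where s: "0 \<le> s" "s < 1" and i: "x0 * ?v + of_int q * s = 1/4 + of_int i"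
        and j: "\<bar>x0 * ?w + of_int p * s - (1/4 + of_int j)\<bar> \<le> 1 / Q"
        using closed_line_hits[OF q, of "x0 * ?v" "x0 * ?w"] unfolding Q_def by blast
      define x where "x = x0 + P * s"
      have sP: "0 \<le> P * s" "P * s \<le> P" using s P0 by (auto simp: mult_le_cancel_left1)
      define e where "e = x * ?w - (1/4 + of_int j)"
      have xv: "x * ?v = 1/4 + of_int i"
        using i unfolding Pv[symmetric] x_def by (simp add: algebra_simps)
      \<comment> \<open>The offset splits into the distance from the closed line to the singularity
        and the drift of the flow from that line, each at most \<open>1 / Q\<close>.\<close>
      have "e = (x0 * ?w + of_int p * s - (1/4 + of_int j)) + s * (P * ?w - of_int p)"
        by (simp add: e_def x_def algebra_simps)
      moreover have "\<bar>s * (P * ?w - of_int p)\<bar> \<le> 1 * (1 / Q)"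
        unfolding abs_mult using s Pw by (intro mult_mono) auto
      ultimately have e: "\<bar>e\<bar> \<le> 2 / Q" using j by linarith
      have "rho (x * ?v) (x * ?w) \<le> 6 * \<bar>e\<bar>"
        using rho_upper[of i 0 j e] xv by (simp add: e_def)
      then have hx: "rho (x * ?v) (x * ?w) \<le> 12 / Q" using e by linarith
      have F_ge: "(B / Q) powr (- \<gamma>) \<le> F y" if y: "y \<in> {x..x + \<delta> / Q}" for y
      proof -
        have "\<delta> / Q \<le> 1 / Q" using \<delta> Q by (intro divide_right_mono) auto
        then have yx: "\<bar>y - x\<bar> \<le> 1 / Q" using y by auto
        have "\<bar>rho (y * ?v) (y * ?w) - rho (x * ?v) (x * ?w)\<bar> \<le> 6 * (\<bar>y * ?v - x * ?v\<bar> + \<bar>y * ?w - x * ?w\<bar>)"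
          by (rule rho_lipschitz)
        also have "\<dots> = 6 * (\<bar>?v\<bar> + \<bar>?w\<bar>) * \<bar>y - x\<bar>"
          unfolding left_diff_distrib[symmetric] abs_mult by (simp add: algebra_simps)
        also have "\<dots> \<le> 6 * (\<bar>?v\<bar> + \<bar>?w\<bar>) * (1 / Q)" using yx by (intro mult_left_mono) auto
        finally have "rho (y * ?v) (y * ?w) \<le> 12 / Q + 6 * (\<bar>?v\<bar> + \<bar>?w\<bar>) / Q" using hx by simp
        also have "\<dots> = B / Q" by (simp add: B_def add_divide_distrib)
        finally show ?thesis
          unfolding F_def using rho_line_pos[OF c] \<gamma> by (intro powr_mono2') auto
      qed
      have "\<delta> * B powr (- \<gamma>) * Q powr (\<gamma> - 1) = \<delta> / Q * (B / Q) powr (- \<gamma>)"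
        using B Q by (simp add: powr_divide powr_diff powr_minus field_simps)
      also have "\<dots> = integral {x..x + \<delta> / Q} (\<lambda>y. (B / Q) powr (- \<gamma>))"
        using \<delta> Q by simp
      also have "\<dots> \<le> integral {x..x + \<delta> / Q} F"
        by (intro integral_le int F_ge) auto
      also have "\<dots> \<le> integral {x0..x0 + 2 * P} F"
      proof (intro integral_subset_le int)
        have "\<delta> / Q \<le> P"
        proof -
          have "\<delta> / Q \<le> \<delta> * Q" using \<delta> Q by (simp add: divide_le_eq mult_le_cancel_left1) (simp add: mult_ge1_I)
          also have "\<dots> \<le> 1 / \<bar>?v\<bar> * Q" using \<delta> Q by (intro mult_right_mono) auto
          finally show ?thesis by (simp add: P_def)
        qed
        then show "{x..x + \<delta> / Q} \<subseteq> {x0..x0 + 2 * P}" using sP by (auto simp: x_def)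
      qed (simp add: F0)
      finally show ?thesis .
    qed
    define H where "H = \<delta> * B powr (- \<gamma>) * Q powr (\<gamma> - 1)"
    have H0: "0 \<le> H" using \<delta> by (simp add: H_def)
    note hit = hit[folded H_def]
    have blocks: "real n * H \<le> integral {0..real n * (2 * P)} F" for n
    proof (induction n)
      case (Suc n)
      have "integral {0..real (Suc n) * (2 * P)} F =
          integral {0..real n * (2 * P)} F + integral {real n * (2 * P)..real (Suc n) * (2 * P)} F"
        using P0 by (intro Henstock_Kurzweil_Integration.integral_combine[symmetric] int) auto
      moreover have "real (Suc n) * (2 * P) = real n * (2 * P) + 2 * P" by (simp add: algebra_simps)
      ultimately show ?case
        using Suc hit[of "real n * (2 * P)"] by (simp add: algebra_simps)
    qed simp
    define n where "n = nat \<lfloor>T / (2 * P)\<rfloor>"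
    have TP: "1 \<le> T / (2 * P)"
    proof -
      have "Q \<le> T * \<bar>?v\<bar> / 2" using qN N by (simp add: Q_def)
      then show ?thesis using Q v by (simp add: P_def field_simps)
    qed
    have n: "T / (4 * P) \<le> real n" "real n \<le> T / (2 * P)"
    proof -
      have "y / 2 \<le> real (nat \<lfloor>y\<rfloor>)" "real (nat \<lfloor>y\<rfloor>) \<le> y" if "1 \<le> y" for y :: real
      proof -
        have "1 \<le> \<lfloor>y\<rfloor>" using that by simp
        then show "y / 2 \<le> real (nat \<lfloor>y\<rfloor>)" "real (nat \<lfloor>y\<rfloor>) \<le> y" by linarith+
      qed
      from this[OF TP] have "T / (2 * P) / 2 \<le> real n" "real n \<le> T / (2 * P)" unfolding n_def .
      then show "T / (4 * P) \<le> real n" "real n \<le> T / (2 * P)" by auto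
    qed
    have "C * T powr ((\<gamma> - 2) / \<sigma>) =
        \<delta> * B powr (- \<gamma>) * \<bar>?v\<bar> / 4 * (c' * (T * \<bar>?v\<bar> / 4) powr (1 / \<sigma>)) powr (\<gamma> - 2)"
    proof -
      have "(c' * (T * \<bar>?v\<bar> / 4) powr (1 / \<sigma>)) powr (\<gamma> - 2) =
          (c' * (\<bar>?v\<bar> / 4) powr (1 / \<sigma>) * T powr (1 / \<sigma>)) powr (\<gamma> - 2)"
        using T1 by (simp add: powr_mult powr_divide mult_ac)
      also have "\<dots> = (c' * (\<bar>?v\<bar> / 4) powr (1 / \<sigma>)) powr (\<gamma> - 2) * T powr ((\<gamma> - 2) / \<sigma>)"
        using T1 c' by (subst powr_mult) (auto simp: powr_powr)
      finally show ?thesis by (simp add: C_def)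
    qed
    also have "\<dots> \<le> \<delta> * B powr (- \<gamma>) * \<bar>?v\<bar> / 4 * Q powr (\<gamma> - 2)"
    proof (intro mult_left_mono powr_mono2)
      have "c' * (T * \<bar>?v\<bar> / 4) powr (1 / \<sigma>) \<le> c' * real N powr (1 / \<sigma>)"
        using N T1 \<sigma> c' by (intro mult_left_mono powr_mono2) auto
      then show "c' * (T * \<bar>?v\<bar> / 4) powr (1 / \<sigma>) \<le> Q" using qc by (simp add: Q_def)
    qed (use \<gamma> c' \<delta> in auto)
    also have "\<dots> = 1 / (4 * P) * H"
      using Q v by (simp add: H_def P_def powr_diff field_simps power2_eq_square)
    also have "\<dots> = 1 / T * (T / (4 * P) * H)" using T1 by simp
    also have "\<dots> \<le> 1 / T * (real n * H)"
      using T1 n H0 by (intro mult_left_mono mult_right_mono) auto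
    also have "\<dots> \<le> 1 / T * integral {0..real n * (2 * P)} F"
      using T1 by (intro mult_left_mono blocks) auto
    also have "\<dots> \<le> 1 / T * integral {0..T} F"
    proof (intro mult_left_mono integral_subset_le int)
      show "{0..real n * (2 * P)} \<subseteq> {0..T}" using n P0 by (auto simp: field_simps)
    qed (use T1 F0 in auto)
    also have "\<dots> = line_average (inv_sqrt_U \<gamma>) \<xi> T"
      unfolding line_average_eq[OF D] F_def ..
    finally show ?thesis .
  qed
  then show ?thesis using that[OF C] eventually_at_top_linorder by blast
qed

subsection \<open>Rates\<close>

text \<open>Both exponents are compared with \<open>(\<gamma> - 2) / 2\<close>; for the left one
  this amounts to \<open>7 * (\<gamma> - 1)\<^sup>2 + 1\<close> being nonnegative.\<close>

lemma power_rate_le: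
  fixes \<gamma> \<sigma> :: real
  assumes "2 < \<gamma>" "0 < \<sigma>" "\<sigma> < 2"
  shows "((\<gamma> - 2) * (3 * \<gamma> - 2)) / ((\<gamma> - 2) * (3 * \<gamma> - 2) + 4 * \<gamma>^2) \<le> (\<gamma> - 2) / \<sigma>"
proof -
  let ?d = "(\<gamma> - 2) * (3 * \<gamma> - 2) + 4 * \<gamma>^2"
  have d: "0 < ?d" using assms by (intro add_pos_pos mult_pos_pos) auto
  have "0 \<le> 7 * (\<gamma> - 1)\<^sup>2 + 1" by simp
  then have "2 * (3 * \<gamma> - 2) \<le> ?d" by (simp add: power2_eq_square algebra_simps)
  then have "(3 * \<gamma> - 2) / ?d \<le> 1 / 2" using d by (simp add: pos_divide_le_eq)
  then have "(\<gamma> - 2) * ((3 * \<gamma> - 2) / ?d) \<le> (\<gamma> - 2) * (1 / 2)"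
    using assms by (intro mult_left_mono) auto
  also have "\<dots> \<le> (\<gamma> - 2) * (1 / \<sigma>)"
    using assms by (intro mult_left_mono frac_le) auto
  finally show ?thesis by simp
qed

lemma line_average_power_lower:
  assumes D: "diophantine_index \<xi> \<sigma>" "\<sigma> < 2" and \<gamma>: "2 < \<gamma>"
  shows "\<exists>C>0. \<forall>\<^sub>F T in at_top. line_average (inv_sqrt_U \<gamma>) \<xi> T
    \<ge> C * T powr (((\<gamma> - 2) * (3 * \<gamma> - 2)) / ((\<gamma> - 2) * (3 * \<gamma> - 2) + 4 * \<gamma>^2))"
proof -
  have \<sigma>: "0 < \<sigma>" using D by (simp add: diophantine_index_def)
  obtain C where C: "0 < C"
    "\<forall>\<^sub>F T in at_top. line_average (inv_sqrt_U \<gamma>) \<xi> T \<ge> C * T powr ((\<gamma> - 2) / \<sigma>)"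
    using line_average_power[OF D(1) \<gamma>] .
  have "\<forall>\<^sub>F T in at_top. line_average (inv_sqrt_U \<gamma>) \<xi> T
    \<ge> C * T powr (((\<gamma> - 2) * (3 * \<gamma> - 2)) / ((\<gamma> - 2) * (3 * \<gamma> - 2) + 4 * \<gamma>^2))"
    using C(2) eventually_ge_at_top[of 1]
  proof eventually_elim
    case (elim T)
    have "C * T powr (((\<gamma> - 2) * (3 * \<gamma> - 2)) / ((\<gamma> - 2) * (3 * \<gamma> - 2) + 4 * \<gamma>^2)) \<le> C * T powr ((\<gamma> - 2) / \<sigma>)"
      using C(1) elim power_rate_le[OF \<gamma> \<sigma> D(2)] by (intro mult_left_mono powr_mono) auto
    then show ?case using elim(1) by linarith
  qed
  with C(1) show ?thesis by blast
qed

text \<open>The single exponent \<open>(2 - \<gamma>) / 6\<close> dominates every claimed one; in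
  the middle range this is \<open>(1 - \<gamma>) * (2 - \<gamma>)\<close> being nonnegative.\<close>

lemma convergence_rates:
  fixes \<gamma> :: real
  assumes "0 < \<gamma>" "\<gamma> < 2"
  shows "1 \<le> \<gamma> \<Longrightarrow> (1/2) * ((2 - \<gamma>) / (2 + \<gamma>)) \<le> (2 - \<gamma>) / 6"
    and "\<gamma> \<le> 1 \<Longrightarrow> (\<gamma> / (1 + \<gamma>)) * ((2 - \<gamma>) / (2 + \<gamma>)) \<le> (2 - \<gamma>) / 6"
    and "\<gamma> \<le> 2/3 \<Longrightarrow> (1/2) * (\<gamma> / (1 + \<gamma>)) \<le> (2 - \<gamma>) / 6"
proof -
  assume "1 \<le> \<gamma>"
  then have "(2 - \<gamma>) / (2 + \<gamma>) \<le> (2 - \<gamma>) / 3" using assms by (intro divide_left_mono) auto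
  then have "(1/2) * ((2 - \<gamma>) / (2 + \<gamma>)) \<le> (1/2) * ((2 - \<gamma>) / 3)" by (rule mult_left_mono) simp
  then show "(1/2) * ((2 - \<gamma>) / (2 + \<gamma>)) \<le> (2 - \<gamma>) / 6" by simp
next
  assume "\<gamma> \<le> 1"
  then have "0 \<le> (1 - \<gamma>) * (2 - \<gamma>)" using assms by simp
  then have "6 * \<gamma> \<le> (1 + \<gamma>) * (2 + \<gamma>)" by (simp add: algebra_simps)
  then have "\<gamma> / ((1 + \<gamma>) * (2 + \<gamma>)) \<le> 1 / 6" using assms by (simp add: pos_divide_le_eq)
  then have "(2 - \<gamma>) * (\<gamma> / ((1 + \<gamma>) * (2 + \<gamma>))) \<le> (2 - \<gamma>) * (1 / 6)"
    using assms by (intro mult_left_mono) auto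
  then show "(\<gamma> / (1 + \<gamma>)) * ((2 - \<gamma>) / (2 + \<gamma>)) \<le> (2 - \<gamma>) / 6" by (simp add: mult_ac)
next
  assume "\<gamma> \<le> 2/3"
  then have "\<gamma> / (1 + \<gamma>) \<le> 2/5" using assms by (simp add: pos_divide_le_eq)
  then have "(1/2) * (\<gamma> / (1 + \<gamma>)) \<le> (1/2) * (2/5)" by (rule mult_left_mono) simp
  then show "(1/2) * (\<gamma> / (1 + \<gamma>)) \<le> (2 - \<gamma>) / 6" using \<open>\<gamma> \<le> 2/3\<close> by simp
qed

theorem proposition1p3:
  fixes \<gamma> :: real
  assumes "\<gamma> > 0"
  shows
    "(\<forall>\<xi>. diophantine_index \<xi> 1 \<longrightarrow>
        (\<gamma> < 2 \<longrightarrow> torus_integrable (inv_sqrt_U \<gamma>)) \<and>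
        (\<forall>T>0. line_integrable (inv_sqrt_U \<gamma>) \<xi> T) \<and>
        (\<exists>C>0. \<forall>\<^sub>F T in at_top.
          (\<gamma> > 2 \<longrightarrow>
             line_average (inv_sqrt_U \<gamma>) \<xi> T
               \<ge> C * T powr (((\<gamma> - 2) * (3 * \<gamma> - 2)) / ((\<gamma> - 2) * (3 * \<gamma> - 2) + 4 * \<gamma>^2))) \<and>
          (\<gamma> = 2 \<longrightarrow>
             line_average (inv_sqrt_U \<gamma>) \<xi> T \<ge> C * \<bar>ln T\<bar>) \<and>
          (1 \<le> \<gamma> \<and> \<gamma> < 2 \<longrightarrow>
             \<bar>line_average (inv_sqrt_U \<gamma>) \<xi> T - torus_integral (inv_sqrt_U \<gamma>)\<bar>
               \<le> C * T powr (- ((1/2) * ((2 - \<gamma>) / (2 + \<gamma>))))) \<and>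
          (2/3 < \<gamma> \<and> \<gamma> < 1 \<longrightarrow>
             \<bar>line_average (inv_sqrt_U \<gamma>) \<xi> T - torus_integral (inv_sqrt_U \<gamma>)\<bar>
               \<le> C * T powr (- ((\<gamma> / (1 + \<gamma>)) * ((2 - \<gamma>) / (2 + \<gamma>))))) \<and>
          (\<gamma> = 2/3 \<longrightarrow>
             \<bar>line_average (inv_sqrt_U \<gamma>) \<xi> T - torus_integral (inv_sqrt_U \<gamma>)\<bar>
               \<le> C * T powr (- (1/5)) * \<bar>ln T\<bar>) \<and>
          (0 < \<gamma> \<and> \<gamma> < 2/3 \<longrightarrow>
             \<bar>line_average (inv_sqrt_U \<gamma>) \<xi> T - torus_integral (inv_sqrt_U \<gamma>)\<bar>
               \<le> C * T powr (- ((1/2) * (\<gamma> / (1 + \<gamma>))))))) \<and>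
     (\<gamma> > 2 \<longrightarrow>
        (\<forall>\<xi> \<sigma>. non_resonant \<xi> \<and> diophantine_index \<xi> \<sigma> \<and> \<sigma> < 2 \<longrightarrow>
           (\<forall>T>0. line_integrable (inv_sqrt_U \<gamma>) \<xi> T) \<and>
           (\<exists>C>0. \<forall>\<^sub>F T in at_top.
             line_average (inv_sqrt_U \<gamma>) \<xi> T
               \<ge> C * T powr (((\<gamma> - 2) * (3 * \<gamma> - 2)) / ((\<gamma> - 2) * (3 * \<gamma> - 2) + 4 * \<gamma>^2)))))"
proof (intro conjI allI impI)
  fix \<xi> assume D: "diophantine_index \<xi> 1" and "\<gamma> < 2"
  then show "torus_integrable (inv_sqrt_U \<gamma>)"
    using torus_truncation(1)[of \<gamma> 1] assms by simp
next
  fix \<xi> and T :: real assume "diophantine_index \<xi> 1"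
  then show "line_integrable (inv_sqrt_U \<gamma>) \<xi> T" by (rule line_integrable_inv_sqrt_U)
next
  fix \<xi> \<sigma> and T :: real assume "non_resonant \<xi> \<and> diophantine_index \<xi> \<sigma> \<and> \<sigma> < 2"
  then show "line_integrable (inv_sqrt_U \<gamma>) \<xi> T" using line_integrable_inv_sqrt_U by blast
next
  fix \<xi> \<sigma> assume "2 < \<gamma>" "non_resonant \<xi> \<and> diophantine_index \<xi> \<sigma> \<and> \<sigma> < 2"
  then show "\<exists>C>0. \<forall>\<^sub>F T in at_top. line_average (inv_sqrt_U \<gamma>) \<xi> T
      \<ge> C * T powr (((\<gamma> - 2) * (3 * \<gamma> - 2)) / ((\<gamma> - 2) * (3 * \<gamma> - 2) + 4 * \<gamma>^2))"
    using line_average_power_lower by blast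
next
  fix \<xi> assume D: "diophantine_index \<xi> 1"
  consider "\<gamma> < 2" | "\<gamma> = 2" | "2 < \<gamma>" by linarith
  then show "\<exists>C>0. \<forall>\<^sub>F T in at_top.
          (\<gamma> > 2 \<longrightarrow>
             line_average (inv_sqrt_U \<gamma>) \<xi> T
               \<ge> C * T powr (((\<gamma> - 2) * (3 * \<gamma> - 2)) / ((\<gamma> - 2) * (3 * \<gamma> - 2) + 4 * \<gamma>^2))) \<and>
          (\<gamma> = 2 \<longrightarrow>
             line_average (inv_sqrt_U \<gamma>) \<xi> T \<ge> C * \<bar>ln T\<bar>) \<and>
          (1 \<le> \<gamma> \<and> \<gamma> < 2 \<longrightarrow>
             \<bar>line_average (inv_sqrt_U \<gamma>) \<xi> T - torus_integral (inv_sqrt_U \<gamma>)\<bar>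
               \<le> C * T powr (- ((1/2) * ((2 - \<gamma>) / (2 + \<gamma>))))) \<and>
          (2/3 < \<gamma> \<and> \<gamma> < 1 \<longrightarrow>
             \<bar>line_average (inv_sqrt_U \<gamma>) \<xi> T - torus_integral (inv_sqrt_U \<gamma>)\<bar>
               \<le> C * T powr (- ((\<gamma> / (1 + \<gamma>)) * ((2 - \<gamma>) / (2 + \<gamma>))))) \<and>
          (\<gamma> = 2/3 \<longrightarrow>
             \<bar>line_average (inv_sqrt_U \<gamma>) \<xi> T - torus_integral (inv_sqrt_U \<gamma>)\<bar>
               \<le> C * T powr (- (1/5)) * \<bar>ln T\<bar>) \<and>
          (0 < \<gamma> \<and> \<gamma> < 2/3 \<longrightarrow>
             \<bar>line_average (inv_sqrt_U \<gamma>) \<xi> T - torus_integral (inv_sqrt_U \<gamma>)\<bar>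
               \<le> C * T powr (- ((1/2) * (\<gamma> / (1 + \<gamma>)))))" (is "\<exists>C>0. \<forall>\<^sub>F T in at_top. ?claim C T")
  proof cases
    case 1
    obtain C where C: "0 < C" and conv: "\<And>T. 1 \<le> T \<Longrightarrow>
      \<bar>line_average (inv_sqrt_U \<gamma>) \<xi> T - torus_integral (inv_sqrt_U \<gamma>)\<bar> \<le> C * T powr (- ((2 - \<gamma>) / 6))"
      using line_average_convergence[OF D assms 1] by blast
    \<comment> \<open>From \<open>exp 1\<close> on the logarithm is at least 1, so its presence for
      \<open>\<gamma> = 2/3\<close> only enlarges the bound.\<close>
    have "\<forall>\<^sub>F T in at_top. ?claim C T"
      using eventually_ge_at_top[of "exp 1"]
    proof eventually_elim
      case (elim T)
      have T: "1 \<le> T" "0 < T" using elim exp_ge_add_one_self[of 1] by linarith+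
      have lnT: "1 \<le> \<bar>ln T\<bar>" using elim T ln_ge_iff[of T 1] by linarith
      have weaken: "\<bar>line_average (inv_sqrt_U \<gamma>) \<xi> T - torus_integral (inv_sqrt_U \<gamma>)\<bar> \<le> C * T powr (- \<tau>)"
        if "\<tau> \<le> (2 - \<gamma>) / 6" for \<tau>
      proof -
        have "C * T powr (- ((2 - \<gamma>) / 6)) \<le> C * T powr (- \<tau>)"
          using that T C by (intro mult_left_mono powr_mono) auto
        then show ?thesis using conv[OF T(1)] by linarith
      qed
      have "\<bar>line_average (inv_sqrt_U \<gamma>) \<xi> T - torus_integral (inv_sqrt_U \<gamma>)\<bar> \<le> C * T powr (- (1/5)) * \<bar>ln T\<bar>"
        if "\<gamma> = 2/3"
      proof -
        have "C * T powr (- (1/5)) * 1 \<le> C * T powr (- (1/5)) * \<bar>ln T\<bar>"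
          using lnT C by (intro mult_left_mono) auto
        moreover have "1/5 \<le> (2 - \<gamma>) / 6" using that by simp
        ultimately show ?thesis using weaken[of "1/5"] by linarith
      qed
      then show ?case
        using 1 convergence_rates[OF assms 1] by (intro conjI impI weaken; simp)
    qed
    with C show ?thesis by blast
  next
    case 2
    have "\<forall>\<^sub>F T in at_top. ?claim (1 / 1728) T"
      using line_average_log[OF D] by eventually_elim (simp add: 2)
    then show ?thesis by (intro exI[of _ "1 / 1728"]) simp
  next
    case 3
    obtain C where C: "0 < C" "\<forall>\<^sub>F T in at_top. line_average (inv_sqrt_U \<gamma>) \<xi> T
      \<ge> C * T powr (((\<gamma> - 2) * (3 * \<gamma> - 2)) / ((\<gamma> - 2) * (3 * \<gamma> - 2) + 4 * \<gamma>^2))"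
      using line_average_power_lower[OF D _ 3] by auto
    have "\<forall>\<^sub>F T in at_top. ?claim C T"
      using C(2) by eventually_elim (use 3 in simp)
    with C(1) show ?thesis by blast
  qed
qed

end
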